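(* Let $\widehat V$ be the group of right fractions of the Zappa–Szép product monoid $\mathcal F\bowtie S_\infty$ and let $\widehat{BV}$ be the group of right fractions of the Zappa–Szép product monoid $\mathcal F\bowtie B_\infty$. Let $\Lambda=\{\lambda_0,\lambda_1,\dots\}$ and $\Sigma=\{\sigma_0,\sigma_1,\dots\}$. Then $\widehat V$ is presented as a group by the generating set $\Lambda\cup\Sigma$ and the relations \begin{itemize} \item $\lambda_q\lambda_m=\lambda_m\lambda_{q+1}$ for $m<q$; \item $\sigma_m^2=1$ for $m\ge 0$; \item $\sigma_m\sigma_n=\sigma_n\sigma_m$ for $|m-n|\ge 2$; \item $\sigma_m\sigma_{m+1}\sigma_m=\sigma_{m+1}\sigma_m\sigma_{m+1}$ for $m\ge 0$; \item $\sigma_q\lambda_m=\lambda_m\sigma_{q+1}$ for $m<q$; \item $\sigma_m\lambda_m=\lambda_{m+1}\sigma_m\sigma_{m+1}$ for $m\ge0$; \item $\sigma_m\lambda_{m+1}=\lambda_m\sigma_{m+1}\sigma_m$ for $m\ge0$; \item $\sigma_q\lambda_m=\lambda_m\sigma_q$ for $m>q+1$; \end{itemize} and $\widehat{BV}$ is presented as a group by the generating set $\Lambda\cup\Sigma$ and the relations \begin{itemize} \item $\lambda_q\lambda_m=\lambda_m\lambda_{q+1}$ for $m<q$; \item $\sigma_m\sigma_n=\sigma_n\sigma_m$ for $|m-n|\ge 2$; \item $\sigma_m\sigma_{m+1}\sigma_m=\sigma_{m+1}\sigma_m\sigma_{m+1}$ for $m\ge 0$; \item $\sigma_q^\epsilon\lambda_m=\lambda_m\sigma_{q+1}^\epsilon$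 for $m<q$, $\epsilon=\pm1$; \item $\sigma_m^\epsilon\lambda_m=\lambda_{m+1}\sigma_m^\epsilon\sigma_{m+1}^\epsilon$ for $m\ge0$, $\epsilon=\pm1$; \item $\sigma_m^\epsilon\lambda_{m+1}=\lambda_m\sigma_{m+1}^\epsilon\sigma_m^\epsilon$ for $m\ge0$, $\epsilon=\pm1$; \item $\sigma_q^\epsilon\lambda_m=\lambda_m\sigma_q^\epsilon$ for $m>q+1$, $\epsilon=\pm1$. \end{itemize}
   Context: Forests. $\mathbb N=\{0,1,2,\dots\}$. A tree is a finite non-empty set $T$ of finite strings over $\{0,1\}$, closed under taking prefixes, with $u0\in T$ if and only if $u1\in T$. Its leaves are the $u\in T$ with $u0,u1\notin T$, ordered left to right (lexicographically); $T$ is trivial if it consists only of the empty string. A forest is a sequence $F=(F_0,F_1,\dots)$ of trees, all but finitely many trivial. The leaves of $F$ are numbered $0,1,2,\dots$ so that all leaves of $F_i$ precede all leaves of $F_j$ when $i<j$, and leaves of one tree are ordered left to right. The product $FG$ attaches $G_j$ at the $j$-th leaf of $F$: $(FG)_i=F_i\cup\bigcup vG_j$, the union over leaves $v$ of $F_i$, where $j$ is the number of $v$ as a leaf of $F$ and $vG_j=\{vu\mid u\in G_j\}$. The set $\mathcal F$ of all forests is a monoid under this product, whose identity is the forest with all trees trivial. $\lambda_i$ denotes the forest whose only non-trivial tree is the $i$-th one, which consists of the empty string, $0$ and $1$. The $\lambda_i$ generate $\mathcal F$. Permutations and braids. $S_\infty$ is the group of finitary permutations of $\mathbb N$, $\sigma_m$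 is the transposition of $m$ and $m+1$, and $(\sigma\tau)(i)=\sigma(\tau(i))$. $B_\infty$ is the braid group on infinitely many strands: generators $\sigma_0,\sigma_1,\dots$, relations $\sigma_m\sigma_n=\sigma_n\sigma_m$ for $|m-n|\ge2$ and $\sigma_m\sigma_{m+1}\sigma_m=\sigma_{m+1}\sigma_m\sigma_{m+1}$. There is the standard surjection $B_\infty\to S_\infty$, $\sigma_m\mapsto\sigma_m$; for $\tau\in B_\infty$, $\tau(j)$ denotes the value at $j$ of the image of $\tau$. Zappa–Szép products. For $A=S_\infty$ or $A=B_\infty$ there are uniquely determined functions $A\times\mathcal F\to\mathcal F$, $(\alpha,u)\mapsto\alpha\cdot u$, and $A\times\mathcal F\to A$, $(\alpha,u)\mapsto\alpha^u$, satisfying, for all $\alpha,\beta\in A$, $u,v\in\mathcal F$: $(\alpha\beta)\cdot u=\alpha\cdot(\beta\cdot u)$, $(\alpha\beta)^u=\alpha^{(\beta\cdot u)}\beta^u$, $\alpha\cdot(uv)=(\alpha\cdot u)(\alpha^u\cdot v)$, $\alpha^{uv}=(\alpha^u)^v$, $\alpha^1=\alpha$, $1\cdot u=u$, $\alpha\cdot1=1$, $1^u=1$, and given on generators ($\epsilon=\pm1$) by $\sigma_q^\epsilon\cdot\lambda_m=\lambda_{\sigma_q(m)}$ and $(\sigma_q^\epsilon)^{\lambda_m}=\sigma_{q+1}^\epsilon$ if $m<q$; $\sigma_q^\epsilon\sigma_{q+1}^\epsilon$ if $m=q$; $\sigma_{q+1}^\epsilon\sigma_q^\epsilon$ if $m=q+1$;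 $\sigma_q^\epsilon$ if $m>q+1$. $\mathcal F\bowtie A$ is the set $\mathcal F\times A$ with product $(u,\alpha)(v,\beta)=(u(\alpha\cdot v),\alpha^v\beta)$, a monoid containing $\mathcal F$ and $A$ as submonoids via $u\mapsto(u,1)$, $\alpha\mapsto(1,\alpha)$; $(u,\alpha)$ is written $u\alpha$. The group of right fractions of a cancellative monoid $M$ in which any two elements have a common right multiple is the (unique up to isomorphism) group containing $M$ as a submonoid in which every element has the form $uv^{-1}$ with $u,v\in M$. The monoids $\mathcal F\bowtie S_\infty$ and $\mathcal F\bowtie B_\infty$ are cancellative with common right multiples. In the presentations, the generators denote the images of the elements of the same name. *)

theory Defs
  imports "HOL-Algebra.Group" "HOL-Combinatorics.Transposition"
begin

section \<open>Forests\<close>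

text \<open>Strings over \<open>{0,1}\<close> are lists of Booleans, with \<open>False\<close> for \<open>0\<close> and \<open>True\<close> for \<open>1\<close>.\<close>

definition is_tree :: "bool list set \<Rightarrow> bool" where
  "is_tree T \<longleftrightarrow> finite T \<and> T \<noteq> {} \<and>
     (\<forall>u v. u @ v \<in> T \<longrightarrow> u \<in> T) \<and>
     (\<forall>u. u @ [False] \<in> T \<longleftrightarrow> u @ [True] \<in> T)"

definition tree_leaves :: "bool list set \<Rightarrow> bool list set" where
  "tree_leaves T = {u \<in> T. u @ [False] \<notin> T \<and> u @ [True] \<notin> T}"

abbreviation trivial_tree :: "bool list set" where
  "trivial_tree \<equiv> {[]}"

type_synonym forest = "nat \<Rightarrow> bool list set"

definition is_forest :: "forest \<Rightarrow> bool" where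
  "is_forest F \<longleftrightarrow> (\<forall>i. is_tree (F i)) \<and> finite {i. F i \<noteq> trivial_tree}"

definition forest_leaves :: "forest \<Rightarrow> (nat \<times> bool list) set" where
  "forest_leaves F = {(i, v). v \<in> tree_leaves (F i)}"

definition leaf_before :: "nat \<times> bool list \<Rightarrow> nat \<times> bool list \<Rightarrow> bool" where
  "leaf_before p q \<longleftrightarrow>
     fst p < fst q \<or> (fst p = fst q \<and> (snd p, snd q) \<in> lexord {(False, True)})"

definition leaf_number :: "forest \<Rightarrow> nat \<times> bool list \<Rightarrow> nat" where
  "leaf_number F q = card {p \<in> forest_leaves F. leaf_before p q}"

definition forest_mult :: "forest \<Rightarrow> forest \<Rightarrow> forest" where
  "forest_mult F G = (\<lambda>i. F i \<union> (\<Union>v \<in> tree_leaves (F i). (@) v ` G (leaf_number F (i, v))))"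

definition forest_monoid :: "forest monoid" where
  "forest_monoid =
     \<lparr>carrier = {F. is_forest F}, mult = forest_mult, one = (\<lambda>_. trivial_tree)\<rparr>"

definition lam :: "nat \<Rightarrow> forest" where
  "lam i = (\<lambda>_. trivial_tree)(i := {[], [False], [True]})"


section \<open>Group presentations\<close>

text \<open>
  A word is a list of signed letters: \<open>(x, True)\<close> is the generator \<open>x\<close> and \<open>(x, False)\<close>
  its formal inverse. A relation \<open>w = w'\<close> is the pair \<open>(w, w')\<close>.
\<close>

type_synonym 'x word = "('x \<times> bool) list"

inductive_set word_cong :: "('x word \<times> 'x word) set \<Rightarrow> ('x word \<times> 'x word) set"
  for R :: "('x word \<times> 'x word) set" where
  refl: "(w, w) \<in> word_cong R"
| sym: "(w, w') \<in> word_cong R \<Longrightarrow> (w', w) \<in> word_cong R"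
| trans: "(w, w') \<in> word_cong R \<Longrightarrow> (w', w'') \<in> word_cong R \<Longrightarrow> (w, w'') \<in> word_cong R"
| cancel: "(u @ [(x, b), (x, \<not> b)] @ v, u @ v) \<in> word_cong R"
| rel: "(r, r') \<in> R \<Longrightarrow> (u @ r @ v, u @ r' @ v) \<in> word_cong R"

definition presented_group :: "('x word \<times> 'x word) set \<Rightarrow> 'x word set monoid" where
  "presented_group R =
     \<lparr>carrier = UNIV // word_cong R,
      mult = (\<lambda>X Y. \<Union>x \<in> X. \<Union>y \<in> Y. word_cong R `` {x @ y}),
      one = word_cong R `` {[]}\<rparr>"

definition generator_class :: "('x word \<times> 'x word) set \<Rightarrow> 'x \<Rightarrow> 'x word set" where
  "generator_class R x = word_cong R `` {[(x, True)]}"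

text \<open>
  \<open>presented_by G f R\<close>: the group \<open>G\<close> is presented by the generators of type \<open>'x\<close> and the
  relations \<open>R\<close>, where the generator \<open>x\<close> denotes the element \<open>f x\<close> of \<open>G\<close>.
\<close>

definition presented_by ::
    "('g, 'b) monoid_scheme \<Rightarrow> ('x \<Rightarrow> 'g) \<Rightarrow> ('x word \<times> 'x word) set \<Rightarrow> bool" where
  "presented_by G f R \<longleftrightarrow>
     (\<exists>h \<in> iso (presented_group R) G. \<forall>x. h (generator_class R x) = f x)"


section \<open>Finitary permutations and braids\<close>

definition S_inf :: "(nat \<Rightarrow> nat) monoid" where
  "S_inf = \<lparr>carrier = {p. bij p \<and> finite {i. p i \<noteq> i}}, mult = (\<circ>), one = id\<rparr>"

definition S_gen :: "nat \<Rightarrow> nat \<Rightarrow> nat" where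
  "S_gen m = transpose m (m + 1)"

text \<open>The argument \<open>s\<close> names the letters used for the braid generators.\<close>

definition braid_rels :: "(nat \<Rightarrow> 'x) \<Rightarrow> ('x word \<times> 'x word) set" where
  "braid_rels s =
     {([(s m, True), (s n, True)], [(s n, True), (s m, True)]) | m n. \<bar>int m - int n\<bar> \<ge> 2} \<union>
     {([(s m, True), (s (m + 1), True), (s m, True)],
       [(s (m + 1), True), (s m, True), (s (m + 1), True)]) | m. True}"

definition B_inf :: "nat word set monoid" where
  "B_inf = presented_group (braid_rels (\<lambda>m. m))"

definition B_gen :: "nat \<Rightarrow> nat word set" where
  "B_gen m = generator_class (braid_rels (\<lambda>m. m)) m"


section \<open>Zappa--Szep products\<close>

text \<open>
  \<open>zappa_szep_actions A s act pw\<close>: on the carriers, \<open>act \<alpha> u\<close> and \<open>pw \<alpha> u\<close> are the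
  functions written \<open>\<alpha> \<cdot> u\<close> and \<open>\<alpha>\<^sup>u\<close>; \<open>s q\<close> is the generator \<open>\<sigma>\<^sub>q\<close> of \<open>A\<close>. The
  permutation of \<open>\<nat>\<close> underlying \<open>\<sigma>\<^sub>q\<close> and its inverse is \<open>S_gen q\<close> for either choice
  of \<open>A\<close>.
\<close>

definition zappa_szep_actions ::
    "'a monoid \<Rightarrow> (nat \<Rightarrow> 'a) \<Rightarrow> ('a \<Rightarrow> forest \<Rightarrow> forest) \<Rightarrow> ('a \<Rightarrow> forest \<Rightarrow> 'a) \<Rightarrow> bool" where
  "zappa_szep_actions A s act pw \<longleftrightarrow>
     (let U = forest_monoid in
       act \<in> carrier A \<rightarrow> carrier U \<rightarrow> carrier U \<and>
       pw \<in> carrier A \<rightarrow> carrier U \<rightarrow> carrier A \<and>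
       (\<forall>\<alpha> \<in> carrier A. \<forall>\<beta> \<in> carrier A. \<forall>u \<in> carrier U.
          act (\<alpha> \<otimes>\<^bsub>A\<^esub> \<beta>) u = act \<alpha> (act \<beta> u) \<and>
          pw (\<alpha> \<otimes>\<^bsub>A\<^esub> \<beta>) u = pw \<alpha> (act \<beta> u) \<otimes>\<^bsub>A\<^esub> pw \<beta> u) \<and>
       (\<forall>\<alpha> \<in> carrier A. \<forall>u \<in> carrier U. \<forall>v \<in> carrier U.
          act \<alpha> (u \<otimes>\<^bsub>U\<^esub> v) = act \<alpha> u \<otimes>\<^bsub>U\<^esub> act (pw \<alpha> u) v \<and>
          pw \<alpha> (u \<otimes>\<^bsub>U\<^esub> v) = pw (pw \<alpha> u) v) \<and>
       (\<forall>\<alpha> \<in> carrier A. pw \<alpha> \<one>\<^bsub>U\<^esub> = \<alpha> \<and> act \<alpha> \<one>\<^bsub>U\<^esub> = \<one>\<^bsub>U\<^esub>) \<and>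
       (\<forall>u \<in> carrier U. act \<one>\<^bsub>A\<^esub> u = u \<and> pw \<one>\<^bsub>A\<^esub> u = \<one>\<^bsub>A\<^esub>) \<and>
       (\<forall>q m. \<forall>\<epsilon> \<in> {1, -1 :: int}.
          act (s q [^]\<^bsub>A\<^esub> \<epsilon>) (lam m) = lam (S_gen q m) \<and>
          pw (s q [^]\<^bsub>A\<^esub> \<epsilon>) (lam m) =
            (if m < q then s (q + 1) [^]\<^bsub>A\<^esub> \<epsilon>
             else if m = q then s q [^]\<^bsub>A\<^esub> \<epsilon> \<otimes>\<^bsub>A\<^esub> s (q + 1) [^]\<^bsub>A\<^esub> \<epsilon>
             else if m = q + 1 then s (q + 1) [^]\<^bsub>A\<^esub> \<epsilon> \<otimes>\<^bsub>A\<^esub> s q [^]\<^bsub>A\<^esub> \<epsilon>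
             else s q [^]\<^bsub>A\<^esub> \<epsilon>)))"

definition zappa_szep_product ::
    "'a monoid \<Rightarrow> ('a \<Rightarrow> forest \<Rightarrow> forest) \<Rightarrow> ('a \<Rightarrow> forest \<Rightarrow> 'a) \<Rightarrow> (forest \<times> 'a) monoid" where
  "zappa_szep_product A act pw =
     \<lparr>carrier = carrier forest_monoid \<times> carrier A,
      mult = (\<lambda>(u, \<alpha>) (v, \<beta>). (u \<otimes>\<^bsub>forest_monoid\<^esub> act \<alpha> v, pw \<alpha> v \<otimes>\<^bsub>A\<^esub> \<beta>)),
      one = (\<one>\<^bsub>forest_monoid\<^esub>, \<one>\<^bsub>A\<^esub>)\<rparr>"


section \<open>Groups of right fractions\<close>

text \<open>The embedding \<open>i\<close> of the monoid \<open>M\<close> as a submonoid of the group \<open>G\<close> is made explicit.\<close>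

definition right_fraction_group :: "'m monoid \<Rightarrow> 'g monoid \<Rightarrow> ('m \<Rightarrow> 'g) \<Rightarrow> bool" where
  "right_fraction_group M G i \<longleftrightarrow>
     group G \<and> i \<in> hom M G \<and> i \<one>\<^bsub>M\<^esub> = \<one>\<^bsub>G\<^esub> \<and> inj_on i (carrier M) \<and>
     (\<forall>g \<in> carrier G. \<exists>u \<in> carrier M. \<exists>v \<in> carrier M. g = i u \<otimes>\<^bsub>G\<^esub> inv\<^bsub>G\<^esub> (i v))"


section \<open>The two presentations\<close>

datatype gen = Lam nat | Sig nat

abbreviation lam_letter :: "nat \<Rightarrow> gen \<times> bool" where
  "lam_letter m \<equiv> (Lam m, True)"

text \<open>The letter for \<open>\<sigma>\<^sub>m\<close> (\<open>e = True\<close>) or its inverse (\<open>e = False\<close>).\<close>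

abbreviation sig_letter :: "bool \<Rightarrow> nat \<Rightarrow> gen \<times> bool" where
  "sig_letter e m \<equiv> (Sig m, e)"

definition forest_rels :: "(gen word \<times> gen word) set" where
  "forest_rels = {([lam_letter q, lam_letter m], [lam_letter m, lam_letter (q + 1)]) | q m. m < q}"

definition involution_rels :: "(gen word \<times> gen word) set" where
  "involution_rels = {([sig_letter True m, sig_letter True m], []) | m. True}"

definition mixed_rels :: "bool \<Rightarrow> (gen word \<times> gen word) set" where
  "mixed_rels e =
     {([sig_letter e q, lam_letter m], [lam_letter m, sig_letter e (q + 1)]) | q m. m < q} \<union>
     {([sig_letter e m, lam_letter m], [lam_letter (m + 1), sig_letter e m, sig_letter e (m + 1)]) | m. True} \<union>
     {([sig_letter e m, lam_letter (m + 1)], [lam_letter m, sig_letter e (m + 1), sig_letter e m]) | m. True} \<union>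
     {([sig_letter e q, lam_letter m], [lam_letter m, sig_letter e q]) | q m. m > q + 1}"

definition V_rels :: "(gen word \<times> gen word) set" where
  "V_rels = forest_rels \<union> involution_rels \<union> braid_rels Sig \<union> mixed_rels True"

definition BV_rels :: "(gen word \<times> gen word) set" where
  "BV_rels = forest_rels \<union> braid_rels Sig \<union> mixed_rels True \<union> mixed_rels False"

fun gen_image ::
    "'a monoid \<Rightarrow> (nat \<Rightarrow> 'a) \<Rightarrow> (forest \<times> 'a \<Rightarrow> 'g) \<Rightarrow> gen \<Rightarrow> 'g" where
  "gen_image A s i (Lam m) = i (lam m, \<one>\<^bsub>A\<^esub>)"
| "gen_image A s i (Sig m) = i (\<one>\<^bsub>forest_monoid\<^esub>, s m)"

end

theory Submission
  imports Defs "HOL-Algebra.Coset"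
begin

text \<open>
  Let \<open>M\<close> be one of the two Zappa--Szep products, \<open>G\<close> its group of right fractions and \<open>P\<close> the
  group with the asserted presentation. The relations hold in \<open>G\<close>, being instances of the
  product formula of \<open>M\<close>, so evaluation of words is a homomorphism \<open>h : P \<rightarrow> G\<close>. The point is to
  construct a monoid homomorphism \<open>\<Phi> : M \<rightarrow> P\<close> with \<open>h \<circ> \<Phi>\<close> the inclusion of \<open>M\<close> in \<open>G\<close>. Given \<open>\<Phi>\<close>,
  everything follows from \<open>G\<close> consisting of fractions (\<open>iso_of_right_fraction_group\<close>): writing
  \<open>a\<^sup>-\<^sup>1u\<close> as a fraction in \<open>G\<close> produces a common right multiple of \<open>a\<close> and \<open>u\<close> in \<open>M\<close>, common right
  multiples turn every element of \<open>P\<close> into a fraction \<open>\<Phi> u (\<Phi> v)\<^sup>-\<^sup>1\<close>, and \<open>h\<close> maps such a fraction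
  to \<open>u v\<^sup>-\<^sup>1\<close>, which is trivial only if \<open>u = v\<close>.

  The map is \<open>\<Phi> (u, \<alpha>) = \<phi>\<^sub>F u \<cdot> \<phi>\<^sub>A \<alpha>\<close>, and it rests on presentations of the two factors.

  For forests, multiplying by \<open>\<lambda>\<^sub>m\<close> on the left is a purely local operation (\<open>graft\<close>): it joins
  the trees \<open>m\<close> and \<open>m + 1\<close> under a new root. The relations \<open>\<lambda>\<^sub>q\<lambda>\<^sub>m = \<lambda>\<^sub>m\<lambda>\<^sub>q\<^sub>+\<^sub>1\<close> sort any word in the
  \<open>\<lambda>\<^sub>m\<close> into one with weakly increasing indices, and such a word can be read off its forest: its
  first letter is the index of the first non-trivial tree. So these relations present the
  forest monoid (\<open>hom_from_forest_monoid\<close>).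

  For finitary permutations the Coxeter relations suffice (\<open>S_inf_presentation\<close>), by the usual coset
  argument along the chain of subgroups generated by \<open>\<sigma>\<^sub>0, \<dots>, \<sigma>\<^sub>n\<close>. For braids there is nothing to show.

  That \<open>\<Phi>\<close> is multiplicative means \<open>\<phi>\<^sub>A \<alpha> \<cdot> \<phi>\<^sub>F v = \<phi>\<^sub>F (\<alpha> \<cdot> v) \<cdot> \<phi>\<^sub>A (\<alpha>\<^sup>v)\<close>. For \<open>\<alpha> = \<sigma>\<^sub>q\<^sup>\<plusminus>\<^sup>1\<close> and \<open>v = \<lambda>\<^sub>m\<close> these
  are the mixed relations; the general case follows by induction on a word for \<open>\<alpha>\<close> and then on
  \<open>v\<close>, using the axioms of the two actions.
\<close>

section \<open>Words and presented groups\<close>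

primrec list_prod :: "('g, 'b) monoid_scheme \<Rightarrow> ('x \<Rightarrow> 'g) \<Rightarrow> 'x list \<Rightarrow> 'g" where
  "list_prod G f [] = \<one>\<^bsub>G\<^esub>"
| "list_prod G f (x # xs) = f x \<otimes>\<^bsub>G\<^esub> list_prod G f xs"

definition signed :: "('g, 'b) monoid_scheme \<Rightarrow> bool \<Rightarrow> 'g \<Rightarrow> 'g" where
  "signed G b g = (if b then g else inv\<^bsub>G\<^esub> g)"

definition word_eval :: "('g, 'b) monoid_scheme \<Rightarrow> ('x \<Rightarrow> 'g) \<Rightarrow> 'x word \<Rightarrow> 'g" where
  "word_eval G f = list_prod G (\<lambda>(x, b). signed G b (f x))"

lemma word_eval_simps [simp]:
  "word_eval G f [] = \<one>\<^bsub>G\<^esub>"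
  "word_eval G f ((x, b) # w) = signed G b (f x) \<otimes>\<^bsub>G\<^esub> word_eval G f w"
  by (simp_all add: word_eval_def)

definition satisfies ::
    "('g, 'b) monoid_scheme \<Rightarrow> ('x \<Rightarrow> 'g) \<Rightarrow> ('x word \<times> 'x word) set \<Rightarrow> bool" where
  "satisfies G f R \<longleftrightarrow> (\<forall>(r, r') \<in> R. word_eval G f r = word_eval G f r')"

lemma satisfies_Un [simp]: "satisfies G f (R \<union> R') \<longleftrightarrow> satisfies G f R \<and> satisfies G f R'"
  by (auto simp: satisfies_def)

lemma satisfies_Collect:
  "satisfies G f {(l m, r m) | m. Q m} \<longleftrightarrow>
     (\<forall>m. Q m \<longrightarrow> word_eval G f (l m) = word_eval G f (r m))"
  "satisfies G f {(l' m n, r' m n) | m n. Q' m n} \<longleftrightarrow>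
     (\<forall>m n. Q' m n \<longrightarrow> word_eval G f (l' m n) = word_eval G f (r' m n))"
  unfolding satisfies_def by blast+

lemma (in monoid) list_prod_closed [simp]:
  "(\<And>x. x \<in> set xs \<Longrightarrow> f x \<in> carrier G) \<Longrightarrow> list_prod G f xs \<in> carrier G"
  by (induction xs) auto

lemma (in monoid) list_prod_append:
  assumes "\<And>x. f x \<in> carrier G"
  shows "list_prod G f (xs @ ys) = list_prod G f xs \<otimes> list_prod G f ys"
  by (induction xs) (auto simp: assms m_assoc)

lemma (in group) signed_closed [simp]: "g \<in> carrier G \<Longrightarrow> signed G b g \<in> carrier G"
  by (simp add: signed_def)

lemma (in group) word_eval_closed [simp]:
  "(\<And>x. f x \<in> carrier G) \<Longrightarrow> word_eval G f w \<in> carrier G"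
  unfolding word_eval_def by (rule list_prod_closed) (simp add: split_beta)

lemma (in group) word_eval_append:
  "(\<And>x. f x \<in> carrier G) \<Longrightarrow> word_eval G f (v @ w) = word_eval G f v \<otimes> word_eval G f w"
  unfolding word_eval_def by (rule list_prod_append) (simp add: split_beta)

lemma (in group) word_eval_cong:
  assumes "(w, w') \<in> word_cong R" and "\<And>x. f x \<in> carrier G" and "satisfies G f R"
  shows "word_eval G f w = word_eval G f w'"
  using assms(1)
proof induction
  case (cancel u x b v)
  have "signed G b (f x) \<otimes> (signed G (\<not> b) (f x) \<otimes> word_eval G f v) = word_eval G f v"
    using assms(2) by (cases b) (simp_all add: signed_def m_assoc [symmetric])
  then show ?case
    by (simp add: word_eval_append assms(2))
next
  case (rel r r' u v)
  then show ?case
    using assms by (auto simp: word_eval_append satisfies_def)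
qed auto

lemma hom_signed:
  assumes "h \<in> hom G H" "group G" "group H" "g \<in> carrier G"
  shows "h (signed G b g) = signed H b (h g)"
proof -
  interpret group_hom G H h
    using assms by (simp add: group_hom_def group_hom_axioms_def)
  show ?thesis
    using assms(4) by (simp add: signed_def)
qed

lemma hom_word_eval:
  assumes h: "h \<in> hom G H" and "group G" "group H" and f: "\<And>x. f x \<in> carrier G"
  shows "h (word_eval G f w) = word_eval H (\<lambda>x. h (f x)) w"
proof -
  interpret group G by fact
  show ?thesis
    using hom_one [OF h] assms
    by (induction w) (auto simp: hom_mult [OF h] hom_signed [OF h])
qed

lemma hom_list_prod:
  assumes h: "h \<in> hom G H" and "group G" "group H" and f: "\<And>x. f x \<in> carrier G"
  shows "h (list_prod G f xs) = list_prod H (\<lambda>x. h (f x)) xs"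
proof -
  interpret group G by fact
  show ?thesis
    using hom_one [OF h] assms by (induction xs) (auto simp: hom_mult [OF h])
qed

text \<open>
  Renaming the letters turns a presentation of \<open>A\<close> into the relations that \<open>A\<close> contributes
  to a larger group.
\<close>

definition letter_rels :: "('x \<Rightarrow> 'y) \<Rightarrow> ('x word \<times> 'x word) set \<Rightarrow> ('y word \<times> 'y word) set" where
  "letter_rels f R = map_prod (map (map_prod f id)) (map (map_prod f id)) ` R"

lemma word_eval_map_letters: "word_eval G f (map (map_prod g id) w) = word_eval G (\<lambda>x. f (g x)) w"
  by (induction w) auto

lemma satisfies_letter_rels: "satisfies G f (letter_rels g R) \<longleftrightarrow> satisfies G (\<lambda>x. f (g x)) R"
  by (simp add: satisfies_def letter_rels_def split_beta word_eval_map_letters)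

lemma letter_rels_Un: "letter_rels f (R \<union> R') = letter_rels f R \<union> letter_rels f R'"
  by (simp add: letter_rels_def image_Un)

lemma letter_rels_Collect:
  "letter_rels f {(l m, r m) | m. Q m} =
     {(map (map_prod f id) (l m), map (map_prod f id) (r m)) | m. Q m}"
  "letter_rels f {(l' m n, r' m n) | m n. Q' m n} =
     {(map (map_prod f id) (l' m n), map (map_prod f id) (r' m n)) | m n. Q' m n}"
  unfolding letter_rels_def by force+

lemma equiv_word_cong: "equiv UNIV (word_cong R)"
  by (rule equivI) (auto simp: refl_on_def sym_def trans_def intro: word_cong.intros)

lemma word_cong_context:
  "(w, w') \<in> word_cong R \<Longrightarrow> (u @ w @ v, u @ w' @ v) \<in> word_cong R"
proof (induction rule: word_cong.induct)
  case (cancel u' x b v')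
  then show ?case
    using word_cong.cancel [of "u @ u'" x b "v' @ v" R] by simp
next
  case (rel r r' u' v')
  then show ?case
    using word_cong.rel [of r r' R "u @ u'" "v' @ v"] by simp
qed (blast intro: word_cong.intros)+

lemma word_cong_append:
  assumes "(v, v') \<in> word_cong R" "(w, w') \<in> word_cong R"
  shows "(v @ w, v' @ w') \<in> word_cong R"
  using word_cong_context [OF assms(1), of "[]" w] word_cong_context [OF assms(2), of v' "[]"]
  by (auto intro: word_cong.trans)

definition word_class :: "('x word \<times> 'x word) set \<Rightarrow> 'x word \<Rightarrow> 'x word set" where
  "word_class R w = word_cong R `` {w}"

lemma word_class_eq_iff: "word_class R w = word_class R w' \<longleftrightarrow> (w, w') \<in> word_cong R"
  unfolding word_class_def using equiv_word_cong by (rule eq_equiv_class_iff) auto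

lemma presented_group_simps:
  shows carrier_presented_group: "carrier (presented_group R) = range (word_class R)"
    and mult_presented_group:
      "word_class R v \<otimes>\<^bsub>presented_group R\<^esub> word_class R w = word_class R (v @ w)"
    and one_presented_group: "\<one>\<^bsub>presented_group R\<^esub> = word_class R []"
proof -
  show "carrier (presented_group R) = range (word_class R)"
    by (auto simp: presented_group_def word_class_def quotient_def)
  have "congruent2 (word_cong R) (word_cong R) (\<lambda>x y. word_class R (x @ y))"
    by (rule congruent2I')
      (auto simp: word_class_eq_iff intro: word_cong_append)
  then have "(\<Union>x \<in> word_class R v. \<Union>y \<in> word_class R w. word_class R (x @ y)) = word_class R (v @ w)"
    unfolding word_class_def [of R v] word_class_def [of R w]
    by (intro UN_equiv_class2 [OF equiv_word_cong equiv_word_cong]) auto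
  then show "word_class R v \<otimes>\<^bsub>presented_group R\<^esub> word_class R w = word_class R (v @ w)"
    by (simp add: presented_group_def word_class_def)
  show "\<one>\<^bsub>presented_group R\<^esub> = word_class R []"
    by (simp add: presented_group_def word_class_def)
qed

definition inverse_word :: "'x word \<Rightarrow> 'x word" where
  "inverse_word w = rev (map (\<lambda>(x, b). (x, \<not> b)) w)"

lemma inverse_word_cong: "(inverse_word w @ w, []) \<in> word_cong R"
proof (induction w)
  case (Cons p w)
  obtain x b where p: "p = (x, b)"
    by (cases p)
  have "(inverse_word w @ [(x, \<not> b), (x, \<not> \<not> b)] @ w, inverse_word w @ w) \<in> word_cong R"
    by (rule word_cong.cancel)
  with Cons show ?case
    by (auto simp: p inverse_word_def intro: word_cong.trans)
qed (simp add: inverse_word_def word_cong.refl)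

lemma group_presented_group: "group (presented_group R)"
proof (rule groupI)
  fix X assume "X \<in> carrier (presented_group R)"
  then obtain w where "X = word_class R w"
    by (auto simp: carrier_presented_group)
  then show "\<exists>Y \<in> carrier (presented_group R). Y \<otimes>\<^bsub>presented_group R\<^esub> X = \<one>\<^bsub>presented_group R\<^esub>"
    using inverse_word_cong [of w R]
    by (intro bexI [of _ "word_class R (inverse_word w)"])
      (auto simp: presented_group_simps word_class_eq_iff)
qed (auto simp: presented_group_simps)

lemma generator_class_conv: "generator_class R x = word_class R [(x, True)]"
  by (simp add: generator_class_def word_class_def)

lemma generator_class_closed [simp]: "generator_class R x \<in> carrier (presented_group R)"
  by (simp add: generator_class_conv carrier_presented_group)

lemma word_eval_generator_class:
  "word_eval (presented_group R) (generator_class R) w = word_class R w"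
proof (induction w)
  case (Cons p w)
  interpret group "presented_group R"
    by (rule group_presented_group)
  obtain x b where p: "p = (x, b)"
    by (cases p)
  have "inv\<^bsub>presented_group R\<^esub> generator_class R x = word_class R [(x, False)]"
    using word_cong.cancel [of "[]" x False "[]" R]
    by (intro inv_equality)
      (auto simp: presented_group_simps generator_class_conv word_class_eq_iff)
  then show ?case
    using Cons by (cases b) (auto simp: p signed_def generator_class_conv presented_group_simps)
qed (simp add: presented_group_simps)

lemma satisfies_presented_group: "R' \<subseteq> R \<Longrightarrow> satisfies (presented_group R) (generator_class R) R'"
  using word_cong.rel [of _ _ R "[]" "[]"]
  by (auto simp: satisfies_def word_eval_generator_class word_class_eq_iff)

text \<open>
  Von Dyck's theorem: evaluation is constant on congruence classes, so it descends to the quotient.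
\<close>

lemma hom_from_presented_group:
  assumes "group G" "\<And>x. f x \<in> carrier G" "satisfies G f R"
  shows "\<exists>h \<in> hom (presented_group R) G. \<forall>w. h (word_class R w) = word_eval G f w"
proof -
  interpret group G by fact
  \<comment> \<open>All words of a class have the same value, so the image of a class is a singleton.\<close>
  define h where "h X = the_elem (word_eval G f ` X)" for X
  have h: "h (word_class R w) = word_eval G f w" for w
  proof -
    have "word_eval G f ` word_class R w = {word_eval G f w}"
      using word_eval_cong [of _ _ R f] assms
      by (auto simp: word_class_def image_iff intro: word_cong.refl)
    then show ?thesis
      by (simp add: h_def)
  qed
  have "h \<in> hom (presented_group R) G"
    by (rule homI) (auto simp: presented_group_simps h word_eval_append assms)
  with h show ?thesis
    by blast
qed

lemma presented_by_presented_group: "presented_by (presented_group R) (generator_class R) R"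
  unfolding presented_by_def
  by (intro bexI [of _ "\<lambda>x. x"]) (auto simp: iso_def hom_def bij_betw_def group.is_monoid monoid.m_closed group_presented_group)

lemma presented_byI:
  assumes "group G" and f: "\<And>x. f x \<in> carrier G" and "satisfies G f R"
    and surj: "\<And>g. g \<in> carrier G \<Longrightarrow> \<exists>w. g = word_eval G f w"
    and inj: "\<And>w. word_eval G f w = \<one>\<^bsub>G\<^esub> \<Longrightarrow> word_class R w = \<one>\<^bsub>presented_group R\<^esub>"
  shows "presented_by G f R"
proof -
  interpret group G by fact
  obtain h where h: "h \<in> hom (presented_group R) G"
    and hw: "\<And>w. h (word_class R w) = word_eval G f w"
    using hom_from_presented_group [OF assms(1-3)] by blast
  interpret group_hom "presented_group R" G h
    using h by (simp add: group_hom_def group_hom_axioms_def group_presented_group assms)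
  have "inj_on h (carrier (presented_group R))"
    by (rule inj_on_one_iff [THEN iffD2])
      (auto simp: carrier_presented_group hw inj)
  moreover have "h ` carrier (presented_group R) = carrier G"
    using surj by (force simp: carrier_presented_group hw f)
  ultimately have "h \<in> iso (presented_group R) G"
    by (simp add: iso_def bij_betw_def h)
  moreover have "h (generator_class R x) = f x" for x
    by (simp add: generator_class_conv hw f signed_def)
  ultimately show ?thesis
    unfolding presented_by_def by blast
qed

lemma presented_byD:
  assumes "presented_by G f R" "group G"
  shows "f x \<in> carrier G" and "satisfies G f R"
    and "g \<in> carrier G \<Longrightarrow> \<exists>w. g = word_eval G f w"
    and "\<lbrakk>group H; \<And>x. t x \<in> carrier H; satisfies H t R\<rbrakk> \<Longrightarrow> \<exists>\<phi> \<in> hom G H. \<forall>x. \<phi> (f x) = t x"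
proof -
  let ?P = "presented_group R"
  interpret P: group ?P
    by (rule group_presented_group)
  obtain k where k: "k \<in> iso ?P G" and kf: "\<And>x. k (generator_class R x) = f x"
    using assms unfolding presented_by_def by blast
  have hom: "k \<in> hom ?P G" and bij: "bij_betw k (carrier ?P) (carrier G)"
    using k by (auto simp: iso_def)
  have kw: "k (word_class R w) = word_eval G f w" for w
    using hom_word_eval [OF hom group_presented_group assms(2), of "generator_class R"]
    by (simp add: word_eval_generator_class kf)
  show f: "f x \<in> carrier G" for x
    using hom_in_carrier [OF hom generator_class_closed] by (simp add: kf)
  have "word_eval G f r = word_eval G f r'" if "(r, r') \<in> R" for r r'
    using word_cong.rel [OF that, of "[]" "[]"]
    by (simp flip: kw word_class_eq_iff)
  then show "satisfies G f R"
    by (auto simp: satisfies_def)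
  show "\<exists>w. g = word_eval G f w" if "g \<in> carrier G"
    using that bij unfolding bij_betw_def carrier_presented_group by (metis imageE kw)
  show "\<exists>\<phi> \<in> hom G H. \<forall>x. \<phi> (f x) = t x"
    if H: "group H" and t: "\<And>x. t x \<in> carrier H" and sat: "satisfies H t R"
  proof -
    interpret H: group H by fact
    obtain h where h: "h \<in> hom ?P H" and hw: "\<And>w. h (word_class R w) = word_eval H t w"
      using hom_from_presented_group [OF H t sat] by blast
    let ?k' = "inv_into (carrier ?P) k"
    have "?k' \<in> hom G ?P"
      using P.iso_set_sym [OF k] by (simp add: iso_def)
    then have "h \<circ> ?k' \<in> hom G H"
      using h by (rule hom_compose)
    moreover have "(h \<circ> ?k') (f x) = t x" for x
      using bij t [of x] hw [of "[(x, True)]"]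
      by (simp flip: kf add: bij_betw_def generator_class_conv signed_def carrier_presented_group)
    ultimately show ?thesis
      by blast
  qed
qed

section \<open>The forest monoid\<close>

abbreviation trivial_forest :: forest where
  "trivial_forest \<equiv> (\<lambda>_. trivial_tree)"

text \<open>
  The product \<open>\<lambda>\<^sub>m F\<close>, described without numbering leaves (\<open>lam_mult\<close>): the trees \<open>m\<close> and \<open>m + 1\<close> of
  \<open>F\<close> become the two subtrees of tree \<open>m\<close>, and later trees move down by one. The inverse
  operation \<open>ungraft\<close> cuts the root off tree \<open>m\<close>.
\<close>

definition graft :: "nat \<Rightarrow> forest \<Rightarrow> forest" where
  "graft m F i =
     (if i < m then F i
      else if i = m then insert [] (Cons False ` F m \<union> Cons True ` F (Suc m))
      else F (Suc i))"

definition ungraft :: "nat \<Rightarrow> forest \<Rightarrow> forest" where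
  "ungraft m F i =
     (if i < m then F i
      else if i = m then {v. False # v \<in> F m}
      else if i = Suc m then {v. True # v \<in> F m}
      else F (i - 1))"

text \<open>
  Where a node of \<open>F\<close> ends up in \<open>graft m F\<close>. This map preserves the order of leaves, hence their numbers.
\<close>

fun graft_node :: "nat \<Rightarrow> nat \<times> bool list \<Rightarrow> nat \<times> bool list" where
  "graft_node m (i, v) =
     (if i < m then (i, v)
      else if i = m then (m, False # v)
      else if i = Suc m then (m, True # v)
      else (i - 1, v))"

lemma inj_graft_node: "inj (graft_node m)"
  by (rule injI) (auto split: if_splits)

lemma graft_node_less:
  "leaf_before (graft_node m p) (graft_node m q) \<longleftrightarrow> leaf_before p q"
  by (cases p; cases q) (auto simp: leaf_before_def)

lemma root_in_tree: "is_tree T \<Longrightarrow> [] \<in> T"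
  by (metis all_not_in_conv append_Nil is_tree_def)

lemma forest_root: "is_forest F \<Longrightarrow> [] \<in> F i"
  by (simp add: is_forest_def root_in_tree)

lemma tree_leaves_graft:
  assumes "is_forest F"
  shows "tree_leaves (graft m F i) =
    (if i < m then tree_leaves (F i)
     else if i = m then Cons False ` tree_leaves (F m) \<union> Cons True ` tree_leaves (F (Suc m))
     else tree_leaves (F (Suc i)))"
  using forest_root [OF assms, of m] forest_root [OF assms, of "Suc m"]
  by (auto simp: tree_leaves_def graft_def image_iff)

lemma forest_leaves_graft:
  assumes "is_forest F"
  shows "forest_leaves (graft m F) = graft_node m ` forest_leaves F"
proof (rule subset_antisym; rule subsetI)
  fix p assume "p \<in> forest_leaves (graft m F)"
  then obtain i v where p: "p = (i, v)" and v: "v \<in> tree_leaves (graft m F i)"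
    by (auto simp: forest_leaves_def)
  consider "i < m" | "i = m" | "i > m"
    by linarith
  then show "p \<in> graft_node m ` forest_leaves F"
  proof cases
    case 1
    then show ?thesis
      using v p by (intro image_eqI [of _ _ "(i, v)"]) (auto simp: forest_leaves_def tree_leaves_graft assms)
  next
    case 2
    then show ?thesis
      using v p
      by (auto simp: forest_leaves_def tree_leaves_graft assms
          intro: image_eqI [of _ _ "(m, _)"] image_eqI [of _ _ "(Suc m, _)"])
  next
    case 3
    then show ?thesis
      using v p by (intro image_eqI [of _ _ "(Suc i, v)"]) (auto simp: forest_leaves_def tree_leaves_graft assms)
  qed
next
  fix p assume "p \<in> graft_node m ` forest_leaves F"
  then show "p \<in> forest_leaves (graft m F)"
    by (auto simp: forest_leaves_def tree_leaves_graft assms split: if_splits)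
qed

lemma leaf_number_graft:
  assumes "is_forest F"
  shows "leaf_number (graft m F) (graft_node m q) = leaf_number F q"
proof -
  have "{p \<in> forest_leaves (graft m F). leaf_before p (graft_node m q)} =
      graft_node m ` {p \<in> forest_leaves F. leaf_before p q}"
    by (auto simp: forest_leaves_graft assms graft_node_less simp del: graft_node.simps)
  then show ?thesis
    unfolding leaf_number_def
    by (simp add: card_image [OF inj_on_subset [OF inj_graft_node subset_UNIV]])
qed

text \<open>
  Associativity \<open>(\<lambda>\<^sub>m F) G = \<lambda>\<^sub>m (F G)\<close>: grafting preserves the numbers of the leaves of \<open>F\<close>, so the same
  trees of \<open>G\<close> are attached to the same leaves. With this, facts about products reduce to
  induction over grafts, starting from the trivial forest.
\<close>

lemma forest_mult_graft:
  assumes "is_forest F"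
  shows "forest_mult (graft m F) G = graft m (forest_mult F G)"
proof
  fix i
  note number = leaf_number_graft [OF assms, of m]
  consider "i < m" | "i = m" | "i > m"
    by linarith
  then show "forest_mult (graft m F) G i = graft m (forest_mult F G) i"
  proof cases
    case 1
    then show ?thesis
      using number [of "(i, _)"] by (simp add: forest_mult_def tree_leaves_graft assms graft_def)
  next
    case 2
    then show ?thesis
      using number [of "(m, _)"] number [of "(Suc m, _)"]
      by (simp add: forest_mult_def tree_leaves_graft assms)
        (simp add: graft_def forest_mult_def image_Un image_UN image_image Un_ac)
  next
    case 3
    then show ?thesis
      using number [of "(Suc i, _)"] by (simp add: forest_mult_def tree_leaves_graft assms graft_def)
  qed
qed

lemma forest_mult_trivial_right: "forest_mult F trivial_forest = F"
  by (auto simp: forest_mult_def tree_leaves_def)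

lemma lam_conv_graft: "lam m = graft m trivial_forest"
  by (auto simp: lam_def graft_def fun_eq_iff)

lemma graft_graft: "m < q \<Longrightarrow> graft q (graft m F) = graft m (graft (Suc q) F)"
  by (auto simp: graft_def fun_eq_iff)

lemma ungraft_graft: "ungraft m (graft m F) = F"
  by (auto simp: graft_def ungraft_def fun_eq_iff image_iff)

lemma is_forest_trivial: "is_forest trivial_forest"
  by (auto simp: is_forest_def is_tree_def)

lemma is_forest_graft:
  assumes F: "is_forest F"
  shows "is_forest (graft m F)"
proof -
  have tree: "is_tree (F i)" for i
    using F by (simp add: is_forest_def)
  note t = tree [unfolded is_tree_def]
  have fin: "finite {i. F i \<noteq> trivial_tree}"
    using F unfolding is_forest_def by blast
  have prefix: "u \<in> F i" if "u @ v \<in> F i" for u v i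
    using t that by blast
  have sibling: "u @ [False] \<in> F i \<longleftrightarrow> u @ [True] \<in> F i" for u i
    using t by blast
  have "is_tree (insert [] (Cons False ` F m \<union> Cons True ` F (Suc m)))"
    unfolding is_tree_def
  proof (intro conjI allI impI)
    show "finite (insert [] (Cons False ` F m \<union> Cons True ` F (Suc m)))"
      using t by auto
    show "u \<in> insert [] (Cons False ` F m \<union> Cons True ` F (Suc m))"
      if "u @ v \<in> insert [] (Cons False ` F m \<union> Cons True ` F (Suc m))" for u v
      using that prefix by (cases u) auto
    show "(u @ [False] \<in> insert [] (Cons False ` F m \<union> Cons True ` F (Suc m))) \<longleftrightarrow>
      (u @ [True] \<in> insert [] (Cons False ` F m \<union> Cons True ` F (Suc m)))" for u
      using sibling forest_root [OF F] by (cases u) auto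
  qed auto
  then have "is_tree (graft m F i)" for i
    using tree by (auto simp: graft_def)
  moreover have "{i. graft m F i \<noteq> trivial_tree} \<subseteq>
      insert m ({i. F i \<noteq> trivial_tree} \<union> (\<lambda>i. i - 1) ` {i. F i \<noteq> trivial_tree})"
  proof
    fix i assume i: "i \<in> {i. graft m F i \<noteq> trivial_tree}"
    show "i \<in> insert m ({i. F i \<noteq> trivial_tree} \<union> (\<lambda>i. i - 1) ` {i. F i \<noteq> trivial_tree})"
    proof (cases "i \<le> m")
      case False
      then show ?thesis
        using i by (intro insertI2 UnI2 image_eqI [of _ _ "Suc i"]) (auto simp: graft_def)
    qed (use i in \<open>auto simp: graft_def split: if_splits\<close>)
  qed
  then have "finite {i. graft m F i \<noteq> trivial_tree}"
    by (rule finite_subset) (intro finite.insertI finite_UnI finite_imageI fin)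
  ultimately show ?thesis
    by (simp add: is_forest_def)
qed

text \<open>
  A non-trivial tree has both children of its root, so that it is a join of two trees.
\<close>

lemma graft_ungraft:
  assumes F: "is_forest F" and m: "F m \<noteq> trivial_tree"
  shows "graft m (ungraft m F) = F"
    and "is_forest (ungraft m F)"
proof -
  have tree: "is_tree (F i)" for i
    using F by (simp add: is_forest_def)
  note t = tree [unfolded is_tree_def]
  have fin: "finite {i. F i \<noteq> trivial_tree}"
    using F unfolding is_forest_def by blast
  obtain x v where "x # v \<in> F m"
    using m forest_root [OF F, of m] by (metis all_not_in_conv insertI1 is_singletonI' is_singleton_the_elem list.exhaust singletonD)
  then have "[x] \<in> F m"
    using t by (metis append_Cons append_Nil)
  then have child: "[b] \<in> F m" for b
    using t [of m] by (metis (full_types) append_Nil)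
  have split: "insert [] (Cons False ` {v. False # v \<in> F m} \<union> Cons True ` {v. True # v \<in> F m}) = F m"
  proof -
    have "u \<in> insert [] (Cons False ` {v. False # v \<in> F m} \<union> Cons True ` {v. True # v \<in> F m})"
      if "u \<in> F m" for u
    proof (cases u)
      case (Cons b v)
      then show ?thesis
        using that by (cases b) auto
    qed simp
    then show ?thesis
      using forest_root [OF F, of m] by auto
  qed
  then show "graft m (ungraft m F) = F"
    by (auto simp: graft_def ungraft_def fun_eq_iff)
  have "is_tree {v. b # v \<in> F m}" for b
    unfolding is_tree_def
  proof (intro conjI allI impI)
    have "{v. b # v \<in> F m} \<subseteq> tl ` F m"
      by force
    then show "finite {v. b # v \<in> F m}"
      using t finite_subset by blast
    show "{v. b # v \<in> F m} \<noteq> {}"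
      using child by auto
    show "u \<in> {v. b # v \<in> F m}" if "u @ v \<in> {v. b # v \<in> F m}" for u v
      using that t [of m] by (metis append_Cons mem_Collect_eq)
    show "(u @ [False] \<in> {v. b # v \<in> F m}) \<longleftrightarrow> (u @ [True] \<in> {v. b # v \<in> F m})" for u
      using t [of m] by (metis append_Cons mem_Collect_eq)
  qed
  then have "is_tree (ungraft m F i)" for i
    using tree by (auto simp: ungraft_def)
  moreover have "{i. ungraft m F i \<noteq> trivial_tree} \<subseteq>
      insert m (insert (Suc m) ({i. F i \<noteq> trivial_tree} \<union> Suc ` {i. F i \<noteq> trivial_tree}))"
  proof
    fix i assume "i \<in> {i. ungraft m F i \<noteq> trivial_tree}"
    then show "i \<in> insert m (insert (Suc m) ({i. F i \<noteq> trivial_tree} \<union> Suc ` {i. F i \<noteq> trivial_tree}))"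
      by (cases i) (auto simp: ungraft_def split: if_splits)
  qed
  then have "finite {i. ungraft m F i \<noteq> trivial_tree}"
    by (rule finite_subset) (intro finite.insertI finite_UnI finite_imageI fin)
  ultimately show "is_forest (ungraft m F)"
    by (simp add: is_forest_def)
qed

text \<open>
  The number of these nodes is finite, since trivial trees contribute nothing, and grows with every graft.
\<close>

definition nonroot_nodes :: "forest \<Rightarrow> (nat \<times> bool list) set" where
  "nonroot_nodes F = {(i, v). v \<in> F i \<and> v \<noteq> []}"

lemma finite_nonroot_nodes:
  assumes "is_forest F"
  shows "finite (nonroot_nodes F)"
proof -
  have "nonroot_nodes F \<subseteq> (SIGMA i : {i. F i \<noteq> trivial_tree}. F i)"
    by (auto simp: nonroot_nodes_def)
  then show ?thesis
    by (rule finite_subset) (use assms in \<open>auto simp: is_forest_def is_tree_def\<close>)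
qed

lemma card_nonroot_nodes_graft:
  assumes "is_forest F"
  shows "card (nonroot_nodes F) < card (nonroot_nodes (graft m F))"
proof -
  have "graft_node m ` nonroot_nodes F \<subseteq> nonroot_nodes (graft m F)"
    by (auto simp: nonroot_nodes_def graft_def split: if_splits)
  \<comment> \<open>The new child of the root is not the image of any old node, as it could only come from the root of tree \<open>m\<close>.\<close>
  moreover have "(m, [False]) \<in> nonroot_nodes (graft m F) - graft_node m ` nonroot_nodes F"
    using forest_root [OF assms, of m] by (auto simp: nonroot_nodes_def graft_def split: if_splits)
  ultimately have "card (graft_node m ` nonroot_nodes F) < card (nonroot_nodes (graft m F))"
    by (intro psubset_card_mono finite_nonroot_nodes is_forest_graft assms) auto
  then show ?thesis
    by (simp add: card_image [OF inj_on_subset [OF inj_graft_node subset_UNIV]])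
qed

text \<open>
  Cutting off a root reduces the number of non-root nodes, so every forest arises from the trivial one by
  grafts. In the monoid this says that the \<open>\<lambda>\<^sub>m\<close> generate.
\<close>

lemma forest_induct [consumes 1, case_names trivial graft]:
  assumes "is_forest F"
    and "Q trivial_forest"
    and "\<And>m F. \<lbrakk>is_forest F; Q F\<rbrakk> \<Longrightarrow> Q (graft m F)"
  shows "Q F"
  using assms(1)
proof (induction "card (nonroot_nodes F)" arbitrary: F rule: less_induct)
  case less
  show ?case
  proof (cases "F = trivial_forest")
    case False
    then obtain m where m: "F m \<noteq> trivial_tree"
      by (auto simp: fun_eq_iff)
    then show ?thesis
      using less assms(3) [of "ungraft m F" m] card_nonroot_nodes_graft [of "ungraft m F" m]
      by (metis graft_ungraft)
  qed (use assms in simp)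
qed

lemma forest_mult_trivial_left: 
  assumes "is_forest G" shows "forest_mult trivial_forest G = G"
proof
  fix i
  have leaves: "tree_leaves trivial_tree = {[]}"
    by (auto simp: tree_leaves_def)
  have "{p \<in> forest_leaves trivial_forest. leaf_before p (i, [])} = (\<lambda>j. (j, [])) ` {..<i}"
    by (auto simp: forest_leaves_def leaves leaf_before_def)
  then have "leaf_number trivial_forest (i, []) = i"
    by (simp add: leaf_number_def card_image inj_on_def)
  then show "forest_mult trivial_forest G i = G i"
    using forest_root [OF assms, of i] by (auto simp: forest_mult_def leaves)
qed

lemma is_forest_mult:
  assumes "is_forest F" "is_forest G"
  shows "is_forest (forest_mult F G)"
  using assms(1)
  by (induction rule: forest_induct)
    (simp_all add: forest_mult_trivial_left forest_mult_graft is_forest_graft assms(2))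

lemma forest_monoid_simps [simp]:
  "carrier forest_monoid = {F. is_forest F}"
  "u \<otimes>\<^bsub>forest_monoid\<^esub> v = forest_mult u v"
  "\<one>\<^bsub>forest_monoid\<^esub> = trivial_forest"
  by (simp_all add: forest_monoid_def)

lemma lam_forest: "is_forest (lam m)"
  by (simp add: lam_conv_graft is_forest_graft is_forest_trivial)

lemma lam_mult: "is_forest F \<Longrightarrow> forest_mult (lam m) F = graft m F"
  by (simp add: lam_conv_graft forest_mult_graft is_forest_trivial forest_mult_trivial_left)

lemma lam_relation: "m < q \<Longrightarrow> forest_mult (lam q) (lam m) = forest_mult (lam m) (lam (Suc q))"
  by (simp add: lam_mult lam_forest) (simp add: lam_conv_graft graft_graft)

section \<open>Normal forms of forests\<close>

text \<open>
  Applying \<open>\<lambda>\<^sub>q\<lambda>\<^sub>m = \<lambda>\<^sub>m\<lambda>\<^sub>q\<^sub>+\<^sub>1\<close> for \<open>m < q\<close> moves a letter \<open>q\<close> to the right past smaller letters, raising it by one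
  each time. As for insertion sort, this yields a weakly increasing word.
\<close>

fun shift_insert :: "nat \<Rightarrow> nat list \<Rightarrow> nat list" where
  "shift_insert q [] = [q]"
| "shift_insert q (m # ms) = (if m < q then m # shift_insert (Suc q) ms else q # m # ms)"

definition shift_sort :: "nat list \<Rightarrow> nat list" where
  "shift_sort ms = foldr shift_insert ms []"

lemma shift_insert_ge:
  "set ms \<subseteq> {a..} \<Longrightarrow> a \<le> q \<Longrightarrow> set (shift_insert q ms) \<subseteq> {a..}"
  by (induction ms arbitrary: q) simp_all

lemma sorted_shift_insert: "sorted ms \<Longrightarrow> sorted (shift_insert q ms)"
proof (induction ms arbitrary: q)
  case (Cons m ms)
  then have "set (shift_insert (Suc q) ms) \<subseteq> {m..}" if "m < q"
    using that by (intro shift_insert_ge) auto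
  with Cons show ?case
    by auto
qed simp

lemma sorted_shift_sort: "sorted (shift_sort ms)"
  by (induction ms) (auto simp: shift_sort_def sorted_shift_insert)

text \<open>
  Stated for any family of operations subject to the shift relation, on an invariant set \<open>S\<close>: it is
  used both for grafting forests and for left multiplication in a target monoid.
\<close>

lemma foldr_shift_sort:
  assumes closed: "\<And>m x. x \<in> S \<Longrightarrow> f m x \<in> S"
    and shift: "\<And>m q x. \<lbrakk>m < q; x \<in> S\<rbrakk> \<Longrightarrow> f q (f m x) = f m (f (Suc q) x)"
    and "a \<in> S"
  shows "foldr f (shift_sort ms) a = foldr f ms a"
proof -
  have in_S: "foldr f ms a \<in> S" for ms
    by (induction ms) (auto simp: closed \<open>a \<in> S\<close>)
  have insert: "foldr f (shift_insert q ms) a = f q (foldr f ms a)" for q ms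
    by (induction ms arbitrary: q) (auto simp: shift in_S)
  show ?thesis
    by (induction ms) (auto simp: shift_sort_def insert)
qed

abbreviation grafts :: "nat list \<Rightarrow> forest" where
  "grafts ms \<equiv> foldr graft ms trivial_forest"

lemma is_forest_grafts: "is_forest (grafts ms)"
  by (induction ms) (auto simp: is_forest_trivial is_forest_graft)

lemma forest_eq_grafts: "is_forest F \<Longrightarrow> \<exists>ms. F = grafts ms"
proof (induction rule: forest_induct)
  case trivial
  then show ?case
    by (metis foldr.simps(1) id_apply)
next
  case (graft m F)
  then show ?case
    by (metis foldr.simps(2) o_apply)
qed

lemma grafts_below: "\<lbrakk>\<forall>x \<in> set ms. a \<le> x; j < a\<rbrakk> \<Longrightarrow> grafts ms j = trivial_tree"
  by (induction ms) (auto simp: graft_def)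

lemma graft_at: "is_forest F \<Longrightarrow> graft m F m \<noteq> trivial_tree"
  using forest_root [of F m] by (auto simp: graft_def)

lemma grafts_eq_trivial_iff: "grafts ms = trivial_forest \<longleftrightarrow> ms = []"
proof (cases ms)
  case (Cons m ms')
  then show ?thesis
    using graft_at [OF is_forest_grafts, of m ms'] by (metis comp_apply foldr.simps(2) list.distinct(1))
qed simp

text \<open>
  The first letter of a weakly increasing word is the index of the first non-trivial tree of its forest,
  and after removing it by \<open>ungraft\<close> the argument repeats.
\<close>

lemma sorted_grafts_inj:
  assumes "sorted ms" "sorted ns" "grafts ms = grafts ns"
  shows "ms = ns"
  using assms
proof (induction ms arbitrary: ns)
  case Nil
  then show ?case
    using grafts_eq_trivial_iff [of ns] by simp
next
  case (Cons m ms)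
  show ?case
  proof (cases ns)
    case Nil
    then show ?thesis
      using Cons.prems grafts_eq_trivial_iff [of "m # ms"] by simp
  next
    case (Cons n ns')
    have eq: "graft m (grafts ms) = graft n (grafts ns')"
      using Cons.prems Cons by simp
    have "grafts (m # ms) j = trivial_tree" if "j < m" for j
      using Cons.prems that by (intro grafts_below [of _ m]) auto
    moreover have "grafts (n # ns') j = trivial_tree" if "j < n" for j
      using Cons.prems Cons that by (intro grafts_below [of _ n]) auto
    moreover have "grafts (m # ms) m \<noteq> trivial_tree" "grafts (n # ns') n \<noteq> trivial_tree"
      using graft_at [OF is_forest_grafts] by simp_all
    ultimately have "m = n"
      using eq by (metis foldr.simps(2) o_apply linorder_neqE_nat)
    moreover from this have "grafts ms = grafts ns'"
      using eq by (metis ungraft_graft)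
    ultimately show ?thesis
      using Cons.IH [of ns'] Cons.prems Cons by simp
  qed
qed

text \<open>
  The relations \<open>\<lambda>\<^sub>q\<lambda>\<^sub>m = \<lambda>\<^sub>m\<lambda>\<^sub>q\<^sub>+\<^sub>1\<close> present the forest monoid: two words for the same forest have the same
  sorted form, hence the same value wherever the relations hold.
\<close>

lemma hom_from_forest_monoid:
  assumes "monoid H" and t: "\<And>m. t m \<in> carrier H"
    and rel: "\<And>m q. m < q \<Longrightarrow> t q \<otimes>\<^bsub>H\<^esub> t m = t m \<otimes>\<^bsub>H\<^esub> t (Suc q)"
  shows "\<exists>\<phi> \<in> hom forest_monoid H. \<phi> trivial_forest = \<one>\<^bsub>H\<^esub> \<and> (\<forall>m. \<phi> (lam m) = t m)"
proof -
  interpret monoid H by fact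
  define val where "val ms = foldr (\<lambda>m x. t m \<otimes>\<^bsub>H\<^esub> x) ms \<one>\<^bsub>H\<^esub>" for ms
  define \<phi> where "\<phi> F = val (SOME ms. F = grafts ms)" for F
  have val_closed: "val ms \<in> carrier H" for ms
    by (induction ms) (auto simp: val_def t)
  have val_sort: "val (shift_sort ms) = val ms" for ms
    unfolding val_def
    by (rule foldr_shift_sort [where S = "carrier H"]) (auto simp: t rel simp flip: m_assoc)
  have grafts_sort: "grafts (shift_sort ms) = grafts ms" for ms
    by (rule foldr_shift_sort [where S = UNIV]) (auto simp: graft_graft)
  have \<phi>_grafts: "\<phi> (grafts ms) = val ms" for ms
  proof -
    define ns where "ns = (SOME ns. grafts ms = grafts ns)"
    have "grafts ms = grafts ns"
      unfolding ns_def by (rule someI) simp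
    then have "shift_sort ms = shift_sort ns"
      by (intro sorted_grafts_inj sorted_shift_sort) (simp add: grafts_sort)
    then have "val ms = val ns"
      by (metis val_sort)
    then show ?thesis
      by (simp add: \<phi>_def ns_def)
  qed
  have closed: "\<phi> F \<in> carrier H" for F
    by (simp add: \<phi>_def val_closed)
  have one: "\<phi> trivial_forest = \<one>\<^bsub>H\<^esub>"
    using \<phi>_grafts [of "[]"] by (simp add: val_def)
  have \<phi>_graft: "\<phi> (graft m F) = t m \<otimes>\<^bsub>H\<^esub> \<phi> F" if F: "is_forest F" for m F
  proof -
    obtain ms where "F = grafts ms"
      using forest_eq_grafts [OF F] by blast
    then show ?thesis
      using \<phi>_grafts [of "m # ms"] \<phi>_grafts [of ms] by (simp add: val_def)
  qed
  have "\<phi> (forest_mult F G) = \<phi> F \<otimes>\<^bsub>H\<^esub> \<phi> G" if "is_forest F" and G: "is_forest G" for F G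
    using that(1)
    by (induction rule: forest_induct)
      (simp_all add: forest_mult_trivial_left forest_mult_graft is_forest_mult G one closed t \<phi>_graft m_assoc)
  then have "\<phi> \<in> hom forest_monoid H"
    by (auto simp: hom_def closed)
  moreover have "\<phi> (lam m) = t m" for m
    by (simp add: lam_conv_graft \<phi>_graft is_forest_trivial one t)
  ultimately show ?thesis
    using one by blast
qed

section \<open>Finitary permutations as a Coxeter group\<close>

definition square_rels :: "(nat \<Rightarrow> 'x) \<Rightarrow> ('x word \<times> 'x word) set" where
  "square_rels s = {([(s m, True), (s m, True)], []) | m. True}"

lemma S_inf_simps [simp]:
  "carrier S_inf = {p. bij p \<and> finite {i. p i \<noteq> i}}"
  "p \<otimes>\<^bsub>S_inf\<^esub> q = p \<circ> q"
  "\<one>\<^bsub>S_inf\<^esub> = id"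
  by (simp_all add: S_inf_def)

lemma group_S_inf: "group S_inf"
proof (rule groupI)
  fix p assume "p \<in> carrier S_inf"
  then have bij: "bij p" and fin: "finite {i. p i \<noteq> i}"
    by auto
  have "inv_into UNIV p i = i \<longleftrightarrow> p i = i" for i
    by (metis bij bij_inv_eq_iff)
  then have "inv_into UNIV p \<in> carrier S_inf"
    using bij fin by (simp add: bij_imp_bij_inv)
  then show "\<exists>q \<in> carrier S_inf. q \<otimes>\<^bsub>S_inf\<^esub> p = \<one>\<^bsub>S_inf\<^esub>"
    using bij by (intro bexI [of _ "inv_into UNIV p"]) (auto simp: bij_def)
next
  fix p q assume p: "p \<in> carrier S_inf" and q: "q \<in> carrier S_inf"
  have "{i. (p \<circ> q) i \<noteq> i} \<subseteq> {i. p i \<noteq> i} \<union> {i. q i \<noteq> i}"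
    by auto
  then have "finite {i. (p \<circ> q) i \<noteq> i}"
    by (rule finite_subset) (use p q in auto)
  then show "p \<otimes>\<^bsub>S_inf\<^esub> q \<in> carrier S_inf"
    using p q by (simp add: bij_comp)
qed (auto simp: comp_assoc)

lemma S_gen_closed: "S_gen m \<in> carrier S_inf"
proof -
  have "{i. S_gen m i \<noteq> i} \<subseteq> {m, Suc m}"
    by (auto simp: S_gen_def transpose_def)
  then show ?thesis
    using finite_subset by (auto simp: S_gen_def)
qed

text \<open>
  A group with elements satisfying the Coxeter relations of the finitary symmetric group. The locale is
  used for two groups: the finitary permutations themselves, and the group that the relations present.
\<close>

locale coxeter = group H for H (structure) +
  fixes t :: "nat \<Rightarrow> 'a"
  assumes t_closed [simp]: "t m \<in> carrier H"
    and t_square: "t m \<otimes> t m = \<one>"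
    and t_commute: "m + 2 \<le> n \<Longrightarrow> t m \<otimes> t n = t n \<otimes> t m"
    and t_braid: "t m \<otimes> t (Suc m) \<otimes> t m = t (Suc m) \<otimes> t m \<otimes> t (Suc m)"
begin

abbreviation E :: "nat list \<Rightarrow> 'a" where
  "E \<equiv> list_prod H t"

lemma inv_t: "inv (t m) = t m"
  by (rule inv_equality) (simp_all add: t_square)

lemma word_eval_positive: "word_eval H t w = E (map fst w)"
  by (induction w) (auto simp: signed_def inv_t)

lemma E_append: "E (ms @ ns) = E ms \<otimes> E ns"
  by (rule list_prod_append) simp

lemma E_commute: "\<forall>m \<in> set ms. m + 2 \<le> j \<or> j + 2 \<le> m \<Longrightarrow> E ms \<otimes> t j = t j \<otimes> E ms"
proof (induction ms)
  case (Cons m ms)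
  then have "t m \<otimes> t j = t j \<otimes> t m"
    using t_commute [of m j] t_commute [of j m] by auto
  with Cons show ?case
    by (simp add: m_assoc) (simp flip: m_assoc)
qed simp

text \<open>
  The word \<open>n, n - 1, \<dots>, k\<close>, empty for \<open>k = n + 1\<close>. As a permutation it maps \<open>k\<close> to \<open>n + 1\<close>.
\<close>

abbreviation cycle :: "nat \<Rightarrow> nat \<Rightarrow> nat list" where
  "cycle n k \<equiv> rev [k..<Suc n]"

text \<open>
  The words \<open>cycle n k\<close> represent the cosets of the subgroup generated by the letters below \<open>n\<close>: right
  multiplication by a letter either moves to a neighbouring coset (\<open>j = k - 1\<close> and \<open>j = k\<close>) or
  fixes the coset, the letter passing to the left of the cycle.
\<close>

lemma cycle_letter:
  assumes "k \<le> Suc n" "j \<le> n"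
  shows "\<exists>ms k'. set ms \<subseteq> {..<n} \<and> k' \<le> Suc n \<and> E (cycle n k) \<otimes> t j = E ms \<otimes> E (cycle n k')"
proof -
  consider "j + 2 \<le> k" | "k = Suc j" | "k = j" | "k < j"
    by linarith
  then show ?thesis
  proof cases
    case 1
    then have "E (cycle n k) \<otimes> t j = t j \<otimes> E (cycle n k)"
      by (intro E_commute) auto
    then show ?thesis
      using 1 assms by (intro exI [of _ "[j]"] exI [of _ k]) auto
  next
    case 2
    have "cycle n j = cycle n k @ [j]"
      using assms 2 by (simp add: upt_conv_Cons)
    then have "E (cycle n k) \<otimes> t j = E (cycle n j)"
      by (simp only: E_append) simp
    then show ?thesis
      using assms by (intro exI [of _ "[]"] exI [of _ j]) auto
  next
    case 3
    have "cycle n k = cycle n (Suc j) @ [j]"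
      using assms 3 by (simp add: upt_conv_Cons)
    then have "E (cycle n k) \<otimes> t j = E (cycle n (Suc j)) \<otimes> t j \<otimes> t j"
      by (simp only: E_append) simp
    also have "\<dots> = E (cycle n (Suc j))"
      by (simp add: m_assoc t_square del: upt_Suc)
    finally show ?thesis
      using assms by (intro exI [of _ "[]"] exI [of _ "Suc j"]) auto
  next
    case 4
    then obtain l where j: "j = Suc l"
      by (cases j) auto
    define hi lo where "hi = cycle n (Suc j)" and "lo = rev [k..<l]"
    have "[k..<Suc n] = [k..<l] @ [l, j] @ [Suc j..<Suc n]"
      using assms 4 j upt_add_eq_append [of k l "Suc n - l"] by (simp add: upt_conv_Cons del: upt_Suc)
    then have split: "E (cycle n k) = E hi \<otimes> (t j \<otimes> (t l \<otimes> E lo))"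
      by (simp add: hi_def lo_def E_append m_assoc del: upt_Suc)
    have lo: "E lo \<otimes> t j = t j \<otimes> E lo"
      by (rule E_commute) (auto simp: lo_def j)
    have hi: "E hi \<otimes> t l = t l \<otimes> E hi"
      by (rule E_commute) (auto simp: hi_def j)
    \<comment> \<open>The letter \<open>j\<close> commutes with the low part and meets \<open>j, j - 1\<close>;
      the braid relation turns it into \<open>j - 1\<close>, which commutes with the high part.\<close>
    have "E (cycle n k) \<otimes> t j = E hi \<otimes> (t j \<otimes> t l \<otimes> t j) \<otimes> E lo"
      by (simp add: split m_assoc lo del: upt_Suc)
    also have "t j \<otimes> t l \<otimes> t j = t l \<otimes> t j \<otimes> t l"
      by (simp add: j t_braid)
    also have "E hi \<otimes> (t l \<otimes> t j \<otimes> t l) \<otimes> E lo = t l \<otimes> E (cycle n k)"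
      by (simp add: split hi del: upt_Suc flip: m_assoc)
    finally show ?thesis
      using assms j by (intro exI [of _ "[l]"] exI [of _ k]) (auto simp del: upt_Suc)
  qed
qed

lemma coset_normal_form:
  assumes "set ns \<subseteq> {..n}"
  shows "\<exists>ms k. set ms \<subseteq> {..<n} \<and> k \<le> Suc n \<and> E ns = E ms \<otimes> E (cycle n k)"
  using assms
proof (induction ns rule: rev_induct)
  case Nil
  then show ?case
    by (intro exI [of _ "[]"] exI [of _ "Suc n"]) auto
next
  case (snoc j ns)
  then obtain ms k where ms: "set ms \<subseteq> {..<n}" and k: "k \<le> Suc n"
    and eq: "E ns = E ms \<otimes> E (cycle n k)"
    by auto
  obtain ms' k' where ms': "set ms' \<subseteq> {..<n}" and k': "k' \<le> Suc n"
    and eq': "E (cycle n k) \<otimes> t j = E ms' \<otimes> E (cycle n k')"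
    using cycle_letter [OF k, of j] snoc.prems by auto
  have "E (ns @ [j]) = E (ms @ ms') \<otimes> E (cycle n k')"
    by (simp add: E_append eq m_assoc eq' del: upt_Suc)
  then show ?case
    using ms ms' k' by (intro exI [of _ "ms @ ms'"] exI [of _ k']) auto
qed

end

interpretation S: coxeter S_inf S_gen
proof -
  interpret group S_inf
    by (rule group_S_inf)
  show "coxeter S_inf S_gen"
  proof
    show "S_gen m \<in> carrier S_inf" for m
      by (rule S_gen_closed)
    show "S_gen m \<otimes>\<^bsub>S_inf\<^esub> S_gen m = \<one>\<^bsub>S_inf\<^esub>" for m
      by (simp add: S_gen_def)
    show "S_gen m \<otimes>\<^bsub>S_inf\<^esub> S_gen n = S_gen n \<otimes>\<^bsub>S_inf\<^esub> S_gen m" if "m + 2 \<le> n" for m n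
    proof -
      have "S_gen m (S_gen n i) = S_gen n (S_gen m i)" for i
      proof -
        consider "i \<in> {m, Suc m}" | "i \<in> {n, Suc n}" | "i \<notin> {m, Suc m, n, Suc n}"
          by blast
        then show ?thesis
          by cases (use that in \<open>auto simp: S_gen_def transpose_apply_other\<close>)
      qed
      then show ?thesis
        by (simp add: fun_eq_iff)
    qed
    show "S_gen m \<otimes>\<^bsub>S_inf\<^esub> S_gen (Suc m) \<otimes>\<^bsub>S_inf\<^esub> S_gen m =
        S_gen (Suc m) \<otimes>\<^bsub>S_inf\<^esub> S_gen m \<otimes>\<^bsub>S_inf\<^esub> S_gen (Suc m)" for m
    proof -
      have "S_gen m (S_gen (Suc m) (S_gen m i)) = S_gen (Suc m) (S_gen m (S_gen (Suc m) i))" for i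
      proof -
        consider "i = m" | "i = Suc m" | "i = Suc (Suc m)" | "i \<notin> {m, Suc m, Suc (Suc m)}"
          by blast
        then show ?thesis
          by cases (auto simp: S_gen_def transpose_apply_other)
      qed
      then show ?thesis
        by (simp add: fun_eq_iff)
    qed
  qed
qed

lemma S_gen_fixes: "i \<notin> {m, Suc m} \<Longrightarrow> S_gen m i = i"
  by (auto simp: S_gen_def)

lemma S_word_fixes: "set ms \<subseteq> {..<n} \<Longrightarrow> n < i \<Longrightarrow> S.E ms i = i"
  by (induction ms) (auto simp: S_gen_fixes)

lemma S_cycle_apply: "k \<le> Suc n \<Longrightarrow> S.E (S.cycle n k) k = Suc n"
proof (induction n)
  case 0
  then show ?case
    by (cases k) (auto simp: S_gen_def)
next
  case (Suc n)
  then show ?case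
    by (cases "k = Suc (Suc n)") (auto simp: S_gen_def)
qed

text \<open>
  If a word in letters up to \<open>n\<close> acts trivially, its coset representative must be the empty word,
  because \<open>n + 1\<close> is fixed by smaller letters whereas \<open>cycle n k\<close> maps \<open>k\<close> to it. So the word equals
  one in letters below \<open>n\<close>.
\<close>

lemma (in coxeter) trivial_permutation_trivial:
  assumes \<pi>: "\<pi> \<in> hom H S_inf" and \<pi>t: "\<And>m. \<pi> (t m) = S_gen m"
    and "set ns \<subseteq> {..<n}" "S.E ns = id"
  shows "E ns = \<one>"
  using assms(3,4)
proof (induction n arbitrary: ns)
  case (Suc n)
  have \<pi>E: "\<pi> (E xs) = S.E xs" for xs
    using hom_list_prod [OF \<pi> is_group group_S_inf t_closed] by (simp add: \<pi>t)
  obtain ms k where ms: "set ms \<subseteq> {..<n}" and k: "k \<le> Suc n"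
    and eq: "E ns = E ms \<otimes> E (cycle n k)"
    using coset_normal_form [of ns n] Suc.prems by (auto simp: lessThan_Suc_atMost)
  have split: "S.E ns = S.E ms \<circ> S.E (S.cycle n k)"
    using arg_cong [OF eq, of \<pi>] hom_mult [OF \<pi>, of "E ms" "E (cycle n k)"]
    by (simp add: \<pi>E del: upt_Suc)
  have "k = S.E ms (Suc n)"
    using fun_cong [OF split, of k] S_cycle_apply [OF k] Suc.prems by (simp del: upt_Suc)
  then have "k = Suc n"
    using S_word_fixes [OF ms, of "Suc n"] by simp
  then show ?case
    using eq split Suc.prems Suc.IH [OF ms] by simp
qed simp

text \<open>
  The same coset argument for permutations: if \<open>p k = n + 1\<close>, then
  \<open>p\<close> composed with the inverse of \<open>cycle n k\<close> fixes \<open>n + 1\<close>.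
\<close>

lemma finitary_permutation_eq_word:
  assumes "bij p" "\<forall>i > n. p i = i"
  shows "\<exists>ms. p = S.E ms"
  using assms
proof (induction n arbitrary: p)
  case 0
  then have "p = id"
    by (metis bij_pointE eq_id_iff gr0I)
  then show ?case
    by (intro exI [of _ "[]"]) simp
next
  case (Suc n)
  obtain k where k: "p k = Suc n"
    using Suc.prems by (metis bij_pointE)
  then have "k \<le> Suc n"
    using Suc.prems(2) [rule_format, of k] by (cases "k \<le> Suc n") auto
  define c where "c = S.E (S.cycle n k)"
  have "set (S.cycle n k) \<subseteq> {..<Suc n}"
    by auto
  then have c: "c k = Suc n" "bij c" "\<forall>i > Suc n. c i = i"
    using S_cycle_apply [OF \<open>k \<le> Suc n\<close>] S.list_prod_closed [of "S.cycle n k" S_gen] S_word_fixes [of "S.cycle n k" "Suc n"] S_gen_closed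
    by (auto simp: c_def simp del: upt_Suc set_rev set_upt)
  define q where "q = p \<circ> inv_into UNIV c"
  have "bij q"
    using c Suc.prems by (simp add: q_def bij_comp bij_imp_bij_inv)
  moreover have "q i = i" if "i > n" for i
  proof (cases "i = Suc n")
    case True
    then show ?thesis
      using c k by (metis bij_inv_eq_iff comp_apply q_def)
  next
    case False
    then have "i > Suc n"
      using that by simp
    then show ?thesis
      using c Suc.prems by (metis bij_inv_eq_iff comp_apply q_def)
  qed
  ultimately obtain ms where "q = S.E ms"
    using Suc.IH by blast
  then have "p = S.E ms \<circ> c"
    using c by (simp add: q_def fun_eq_iff bij_is_inj)
      (metis bij_inv_eq_iff comp_apply q_def)
  then have "p = S.E (ms @ S.cycle n k)"
    using S.E_append [of ms "S.cycle n k"] by (simp add: c_def del: upt_Suc)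
  then show ?case
    by blast
qed

lemma satisfies_coxeter:
  assumes "group H" "\<And>m. t m \<in> carrier H" "satisfies H t (square_rels id)" "satisfies H t (braid_rels id)"
  shows "coxeter H t"
proof -
  interpret group H by fact
  show ?thesis
  proof
    show "t m \<otimes>\<^bsub>H\<^esub> t m = \<one>\<^bsub>H\<^esub>" for m
      using assms by (force simp: satisfies_def square_rels_def signed_def)
    show "t m \<otimes>\<^bsub>H\<^esub> t n = t n \<otimes>\<^bsub>H\<^esub> t m" if "m + 2 \<le> n" for m n
    proof -
      have "([(m, True), (n, True)], [(n, True), (m, True)]) \<in> braid_rels id"
        using that by (force simp: braid_rels_def)
      then show ?thesis
        using assms by (fastforce simp: satisfies_def signed_def)
    qed
    show "t m \<otimes>\<^bsub>H\<^esub> t (Suc m) \<otimes>\<^bsub>H\<^esub> t m = t (Suc m) \<otimes>\<^bsub>H\<^esub> t m \<otimes>\<^bsub>H\<^esub> t (Suc m)" for m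
    proof -
      have "([(m, True), (Suc m, True), (m, True)], [(Suc m, True), (m, True), (Suc m, True)]) \<in> braid_rels id"
        by (force simp: braid_rels_def)
      then show ?thesis
        using assms by (fastforce simp: satisfies_def signed_def m_assoc)
    qed
  qed (use assms in auto)
qed

lemma coxeter_satisfies:
  assumes "coxeter H t"
  shows "satisfies H t (square_rels id)" and "satisfies H t (braid_rels id)"
proof -
  interpret coxeter H t by fact
  show "satisfies H t (square_rels id)"
    by (auto simp: satisfies_def square_rels_def signed_def t_square)
  have "t m \<otimes>\<^bsub>H\<^esub> t n = t n \<otimes>\<^bsub>H\<^esub> t m" if "\<bar>int m - int n\<bar> \<ge> 2" for m n
    using that t_commute [of m n] t_commute [of n m] by (cases "m \<le> n") auto
  then show "satisfies H t (braid_rels id)"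
    using t_braid by (auto simp: satisfies_def braid_rels_def signed_def m_assoc)
qed

theorem S_inf_presentation: "presented_by S_inf S_gen (square_rels id \<union> braid_rels id)"
proof (rule presented_byI)
  let ?R = "square_rels id \<union> braid_rels id :: (nat word \<times> nat word) set"
  let ?P = "presented_group ?R"
  let ?t = "generator_class ?R"
  interpret P: coxeter ?P ?t
    by (intro satisfies_coxeter group_presented_group generator_class_closed satisfies_presented_group) auto
  show sat: "satisfies S_inf S_gen ?R"
    using coxeter_satisfies [OF S.coxeter_axioms] by simp
  show "\<exists>w. p = word_eval S_inf S_gen w" if p: "p \<in> carrier S_inf" for p
  proof -
    obtain n where "\<forall>i \<in> {i. p i \<noteq> i}. i \<le> n"
      using p finite_nat_set_iff_bounded_le [of "{i. p i \<noteq> i}"] by auto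
    then obtain ms where "p = S.E ms"
      using p finitary_permutation_eq_word [of p n] by force
    then show ?thesis
      by (intro exI [of _ "map (\<lambda>m. (m, True)) ms"]) (simp add: S.word_eval_positive comp_def)
  qed
  show "word_class ?R w = \<one>\<^bsub>?P\<^esub>" if w: "word_eval S_inf S_gen w = \<one>\<^bsub>S_inf\<^esub>" for w
  proof -
    obtain \<pi> where \<pi>: "\<pi> \<in> hom ?P S_inf" "\<And>w. \<pi> (word_class ?R w) = word_eval S_inf S_gen w"
      using hom_from_presented_group [OF group_S_inf S_gen_closed sat] by blast
    obtain n where "set (map fst w) \<subseteq> {..<n}"
      using finite_nat_set_iff_bounded [of "set (map fst w)"] by auto
    then have "P.E (map fst w) = \<one>\<^bsub>?P\<^esub>"
      using \<pi> w P.trivial_permutation_trivial [of \<pi> "map fst w" n]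
      by (simp add: generator_class_conv signed_def S.word_eval_positive)
    then show ?thesis
      by (simp flip: P.word_eval_positive add: word_eval_generator_class)
  qed
qed (use group_S_inf S_gen_closed in auto)

section \<open>Groups of right fractions\<close>

text \<open>
  A homomorphism to a group of fractions is an isomorphism as soon as the inclusion of the monoid lifts
  through it, provided that the lifted elements generate. The lift makes every element of the presented
  group a fraction of monoid elements, and fractions are compared in \<open>G\<close>.
\<close>

lemma iso_of_right_fraction_group:
  assumes fractions: "right_fraction_group M G i"
    and closed: "\<And>a b. \<lbrakk>a \<in> carrier M; b \<in> carrier M\<rbrakk> \<Longrightarrow> a \<otimes>\<^bsub>M\<^esub> b \<in> carrier M"
    and h: "h \<in> hom (presented_group R) G"
    and \<Phi>: "\<Phi> \<in> hom M (presented_group R)"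
    and h\<Phi>: "\<And>a. a \<in> carrier M \<Longrightarrow> h (\<Phi> a) = i a"
    and gens: "\<And>x. generator_class R x \<in> \<Phi> ` carrier M"
    and one: "\<one>\<^bsub>M\<^esub> \<in> carrier M" "\<Phi> \<one>\<^bsub>M\<^esub> = \<one>\<^bsub>presented_group R\<^esub>"
  shows "h \<in> iso (presented_group R) G"
proof -
  let ?P = "presented_group R"
  let ?C = "carrier M"
  have i: "i \<in> hom M G" and inj: "inj_on i ?C" and "group G"
    and frac: "\<And>g. g \<in> carrier G \<Longrightarrow> \<exists>u \<in> ?C. \<exists>v \<in> ?C. g = i u \<otimes>\<^bsub>G\<^esub> inv\<^bsub>G\<^esub> (i v)"
    using fractions by (auto simp: right_fraction_group_def)
  interpret G: group G by fact
  interpret P: group ?P by (rule group_presented_group)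
  interpret h: group_hom ?P G h
    using h by (simp add: group_hom_def group_hom_axioms_def P.is_group G.is_group)
  have \<Phi>C [simp]: "\<Phi> a \<in> carrier ?P" if "a \<in> ?C" for a
    using hom_in_carrier [OF \<Phi> that] .
  have iC [simp]: "i a \<in> carrier G" if "a \<in> ?C" for a
    using hom_in_carrier [OF i that] .
  \<comment> \<open>The fraction \<open>c d\<^sup>-\<^sup>1\<close> for \<open>a\<^sup>-\<^sup>1 u\<close> gives the common right multiple \<open>a c = u d\<close>,
    first in \<open>G\<close> and by injectivity in \<open>M\<close>.\<close>
  have ore: "\<exists>c \<in> ?C. \<exists>d \<in> ?C. a \<otimes>\<^bsub>M\<^esub> c = u \<otimes>\<^bsub>M\<^esub> d" if a: "a \<in> ?C" and u: "u \<in> ?C" for a u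
  proof -
    obtain c d where c: "c \<in> ?C" and d: "d \<in> ?C"
      and eq: "inv\<^bsub>G\<^esub> (i a) \<otimes>\<^bsub>G\<^esub> i u = i c \<otimes>\<^bsub>G\<^esub> inv\<^bsub>G\<^esub> (i d)"
      using frac [of "inv\<^bsub>G\<^esub> (i a) \<otimes>\<^bsub>G\<^esub> i u"] a u by auto
    have "i a \<otimes>\<^bsub>G\<^esub> i c = i a \<otimes>\<^bsub>G\<^esub> (i c \<otimes>\<^bsub>G\<^esub> inv\<^bsub>G\<^esub> (i d)) \<otimes>\<^bsub>G\<^esub> i d"
      using a c d by (simp add: G.m_assoc)
    also have "\<dots> = i u \<otimes>\<^bsub>G\<^esub> i d"
      using a u d by (simp flip: eq G.m_assoc)
    finally have "i (a \<otimes>\<^bsub>M\<^esub> c) = i (u \<otimes>\<^bsub>M\<^esub> d)"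
      by (simp add: hom_mult [OF i] a u c d)
    then show ?thesis
      using inj c d closed a u unfolding inj_on_def by blast
  qed
  have fraction: "\<exists>u \<in> ?C. \<exists>v \<in> ?C. word_class R w = \<Phi> u \<otimes>\<^bsub>?P\<^esub> inv\<^bsub>?P\<^esub> (\<Phi> v)" for w
  proof (induction w)
    case Nil
    then show ?case
      using one by (intro bexI [of _ "\<one>\<^bsub>M\<^esub>"]) (auto simp: one_presented_group [symmetric])
  next
    case (Cons p w)
    obtain x b where p: "p = (x, b)"
      by (cases p)
    obtain a where a: "a \<in> ?C" "generator_class R x = \<Phi> a"
      using gens by blast
    from Cons obtain u v where u: "u \<in> ?C" and v: "v \<in> ?C"
      and w: "word_class R w = \<Phi> u \<otimes>\<^bsub>?P\<^esub> inv\<^bsub>?P\<^esub> (\<Phi> v)"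
      by blast
    have step: "word_class R (p # w) = signed ?P b (\<Phi> a) \<otimes>\<^bsub>?P\<^esub> (\<Phi> u \<otimes>\<^bsub>?P\<^esub> inv\<^bsub>?P\<^esub> (\<Phi> v))"
      using word_eval_generator_class [of R "p # w"] by (simp add: p a word_eval_generator_class w)
    show ?case
    proof (cases b)
      case True
      then have "word_class R (p # w) = \<Phi> (a \<otimes>\<^bsub>M\<^esub> u) \<otimes>\<^bsub>?P\<^esub> inv\<^bsub>?P\<^esub> (\<Phi> v)"
        using a u v by (simp add: step signed_def hom_mult [OF \<Phi>] P.m_assoc)
      then show ?thesis
        using a u v closed by blast
    next
      case False
      obtain c d where c: "c \<in> ?C" and d: "d \<in> ?C" and cd: "a \<otimes>\<^bsub>M\<^esub> c = u \<otimes>\<^bsub>M\<^esub> d"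
        using ore [OF a(1) u] by blast
      have cd': "\<Phi> a \<otimes>\<^bsub>?P\<^esub> \<Phi> c = \<Phi> u \<otimes>\<^bsub>?P\<^esub> \<Phi> d"
        using arg_cong [OF cd, of \<Phi>] by (simp add: hom_mult [OF \<Phi>] a u c d)
      have "\<Phi> u = \<Phi> a \<otimes>\<^bsub>?P\<^esub> \<Phi> c \<otimes>\<^bsub>?P\<^esub> inv\<^bsub>?P\<^esub> (\<Phi> d)"
        using u d by (simp add: cd' P.m_assoc)
      then have "word_class R (p # w) = \<Phi> c \<otimes>\<^bsub>?P\<^esub> inv\<^bsub>?P\<^esub> (\<Phi> d) \<otimes>\<^bsub>?P\<^esub> inv\<^bsub>?P\<^esub> (\<Phi> v)"
        using a c d v False by (simp add: step signed_def) (simp flip: P.m_assoc)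
      also have "\<dots> = \<Phi> c \<otimes>\<^bsub>?P\<^esub> inv\<^bsub>?P\<^esub> (\<Phi> (v \<otimes>\<^bsub>M\<^esub> d))"
        using c d v by (simp add: hom_mult [OF \<Phi>] P.inv_mult_group P.m_assoc)
      finally show ?thesis
        using c d v closed by blast
    qed
  qed
  have h_fraction: "h (\<Phi> u \<otimes>\<^bsub>?P\<^esub> inv\<^bsub>?P\<^esub> (\<Phi> v)) = i u \<otimes>\<^bsub>G\<^esub> inv\<^bsub>G\<^esub> (i v)"
    if "u \<in> ?C" "v \<in> ?C" for u v
    using that by (simp add: h\<Phi>)
  have "g \<in> h ` carrier ?P" if g: "g \<in> carrier G" for g
  proof -
    obtain u v where "u \<in> ?C" "v \<in> ?C" "g = i u \<otimes>\<^bsub>G\<^esub> inv\<^bsub>G\<^esub> (i v)"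
      using frac [OF g] by blast
    then show ?thesis
      by (intro image_eqI [of _ _ "\<Phi> u \<otimes>\<^bsub>?P\<^esub> inv\<^bsub>?P\<^esub> (\<Phi> v)"]) (simp_all add: h_fraction del: h.hom_mult)
  qed
  moreover have "inj_on h (carrier ?P)"
  proof (rule h.inj_on_one_iff [THEN iffD2], intro allI impI)
    fix X assume X: "X \<in> carrier ?P" "h X = \<one>\<^bsub>G\<^esub>"
    then obtain w where "X = word_class R w"
      by (auto simp: carrier_presented_group)
    then obtain u v where u: "u \<in> ?C" and v: "v \<in> ?C" and Xuv: "X = \<Phi> u \<otimes>\<^bsub>?P\<^esub> inv\<^bsub>?P\<^esub> (\<Phi> v)"
      using fraction [of w] by blast
    then have "i u \<otimes>\<^bsub>G\<^esub> inv\<^bsub>G\<^esub> (i v) = \<one>\<^bsub>G\<^esub>"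
      using X h_fraction by simp
    then have "i u = i v"
      using u v by (metis G.inv_closed G.inv_equality G.inv_inv iC)
    then have "u = v"
      using inj_onD [OF inj] u v by blast
    then show "X = \<one>\<^bsub>?P\<^esub>"
      using v by (simp add: Xuv)
  qed
  ultimately show ?thesis
    by (auto simp: iso_def bij_betw_def h)
qed

section \<open>The presentation of the group of fractions\<close>

text \<open>
  The common form of both presentations, for any presentation \<open>R\<^sub>A\<close> of the group \<open>A\<close>. The mixed relations
  for inverse letters may be listed among \<open>R\<close> or merely follow from \<open>R\<close>: the first happens for
  braids, the second for permutations, where every \<open>\<sigma>\<^sub>m\<close> is its own inverse.
\<close>

theorem zappa_szep_fraction_group_presentation:
  fixes A :: "'a monoid" and G :: "'g monoid"
  assumes A: "group A" and pres: "presented_by A s R\<^sub>A"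
    and zs: "zappa_szep_actions A s act pw"
    and fractions: "right_fraction_group (zappa_szep_product A act pw) G i"
    and R_lower: "forest_rels \<union> mixed_rels True \<union> letter_rels Sig R\<^sub>A \<subseteq> R"
    and R_upper: "R \<subseteq> forest_rels \<union> mixed_rels True \<union> mixed_rels False \<union> letter_rels Sig R\<^sub>A"
    and R_mixed: "satisfies (presented_group R) (generator_class R) (mixed_rels False)"
  shows "presented_by G (gen_image A s i) R"
proof -
  let ?P = "presented_group R"
  let ?M = "zappa_szep_product A act pw"
  let ?one = trivial_forest
  let ?f = "gen_image A s i"
  interpret A: group A by fact
  interpret P: group ?P by (rule group_presented_group)
  have i: "i \<in> hom ?M G" and i_one: "i \<one>\<^bsub>?M\<^esub> = \<one>\<^bsub>G\<^esub>" and "group G"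
    using fractions by (auto simp: right_fraction_group_def)
  interpret G: group G by fact

  have act [simp]: "is_forest (act \<alpha> u)" and pw [simp]: "pw \<alpha> u \<in> carrier A"
    if "\<alpha> \<in> carrier A" "is_forest u" for \<alpha> u
    using zs that by (auto simp: zappa_szep_actions_def Let_def Pi_iff)
  have act_mult: "act (\<alpha> \<otimes>\<^bsub>A\<^esub> \<beta>) u = act \<alpha> (act \<beta> u)"
    and pw_mult: "pw (\<alpha> \<otimes>\<^bsub>A\<^esub> \<beta>) u = pw \<alpha> (act \<beta> u) \<otimes>\<^bsub>A\<^esub> pw \<beta> u"
    if "\<alpha> \<in> carrier A" "\<beta> \<in> carrier A" "is_forest u" for \<alpha> \<beta> u
    using zs that by (auto simp: zappa_szep_actions_def Let_def)
  have act_forest: "act \<alpha> (forest_mult u v) = forest_mult (act \<alpha> u) (act (pw \<alpha> u) v)"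
    and pw_forest: "pw \<alpha> (forest_mult u v) = pw (pw \<alpha> u) v"
    if "\<alpha> \<in> carrier A" "is_forest u" "is_forest v" for \<alpha> u v
    using zs that by (auto simp: zappa_szep_actions_def Let_def)
  have trivial [simp]: "pw \<alpha> ?one = \<alpha>" "act \<alpha> ?one = ?one" if "\<alpha> \<in> carrier A" for \<alpha>
    using zs that by (auto simp: zappa_szep_actions_def Let_def)
  have one [simp]: "act \<one>\<^bsub>A\<^esub> u = u" "pw \<one>\<^bsub>A\<^esub> u = \<one>\<^bsub>A\<^esub>" if "is_forest u" for u
    using zs that by (auto simp: zappa_szep_actions_def Let_def)
  have s [simp]: "s q \<in> carrier A" for q
    using presented_byD(1) [OF pres A] .
  have pow: "s q [^]\<^bsub>A\<^esub> (if e then 1 else - 1 :: int) = signed A e (s q)" for q e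
    using A.int_pow_neg [of "s q" 1] by (simp add: signed_def)
  have act_gen: "act (signed A e (s q)) (lam m) = lam (S_gen q m)"
    and pw_gen: "pw (signed A e (s q)) (lam m) =
      (if m < q then signed A e (s (q + 1))
       else if m = q then signed A e (s q) \<otimes>\<^bsub>A\<^esub> signed A e (s (q + 1))
       else if m = q + 1 then signed A e (s (q + 1)) \<otimes>\<^bsub>A\<^esub> signed A e (s q)
       else signed A e (s q))" for e q m
    using zs unfolding zappa_szep_actions_def Let_def
    by (cases e; simp flip: pow)+

  have M_simps [simp]: "carrier ?M = {F. is_forest F} \<times> carrier A"
    "(u, \<alpha>) \<otimes>\<^bsub>?M\<^esub> (v, \<beta>) = (forest_mult u (act \<alpha> v), pw \<alpha> v \<otimes>\<^bsub>A\<^esub> \<beta>)"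
    "\<one>\<^bsub>?M\<^esub> = (?one, \<one>\<^bsub>A\<^esub>)" for u v \<alpha> \<beta>
    by (auto simp: zappa_szep_product_def)
  note forest [simp] = is_forest_mult is_forest_trivial lam_forest forest_mult_trivial_left forest_mult_trivial_right
  define iF where "iF u = i (u, \<one>\<^bsub>A\<^esub>)" for u
  define iA where "iA \<alpha> = i (?one, \<alpha>)" for \<alpha>
  have iF: "iF \<in> hom forest_monoid G"
    using hom_in_carrier [OF i] hom_mult [OF i, of "(_, \<one>\<^bsub>A\<^esub>)" "(_, \<one>\<^bsub>A\<^esub>)"]
    by (auto simp: hom_def iF_def)
  have iA: "iA \<in> hom A G"
    using hom_in_carrier [OF i] hom_mult [OF i, of "(?one, _)" "(?one, _)"]
    by (auto simp: hom_def iA_def)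
  have i_split: "i (u, \<alpha>) = iF u \<otimes>\<^bsub>G\<^esub> iA \<alpha>" if "is_forest u" "\<alpha> \<in> carrier A" for u \<alpha>
    using hom_mult [OF i, of "(u, \<one>\<^bsub>A\<^esub>)" "(?one, \<alpha>)"] that by (simp add: iF_def iA_def)
  have swap: "iA \<alpha> \<otimes>\<^bsub>G\<^esub> iF u = iF (act \<alpha> u) \<otimes>\<^bsub>G\<^esub> iA (pw \<alpha> u)"
    if "is_forest u" "\<alpha> \<in> carrier A" for u \<alpha>
    using hom_mult [OF i, of "(?one, \<alpha>)" "(u, \<one>\<^bsub>A\<^esub>)"] i_split [of "act \<alpha> u" "pw \<alpha> u"] that
    by (simp add: iF_def iA_def)

  have f_simps: "?f (Lam m) = iF (lam m)" "?f (Sig m) = iA (s m)" for m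
    by (simp_all add: iF_def iA_def)
  have f [simp]: "?f x \<in> carrier G" for x
    using hom_in_carrier [OF iF] hom_in_carrier [OF iA] by (cases x) (simp_all add: f_simps del: gen_image.simps)
  have signed_iA: "signed G e (iA (s m)) = iA (signed A e (s m))" for e m
    by (simp add: hom_signed [OF iA A \<open>group G\<close>] del: gen_image.simps)
  have "satisfies G ?f forest_rels"
  proof -
    have "iF (lam q) \<otimes>\<^bsub>G\<^esub> iF (lam m) = iF (lam m) \<otimes>\<^bsub>G\<^esub> iF (lam (Suc q))" if "m < q" for m q
      using hom_mult [OF iF, of "lam q" "lam m"] hom_mult [OF iF, of "lam m" "lam (Suc q)"]
      by (simp add: lam_relation [OF that])
    then show ?thesis
      using hom_in_carrier [OF iF] by (auto simp: satisfies_def forest_rels_def signed_def f_simps simp del: gen_image.simps)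
  qed
  moreover have "satisfies G ?f (mixed_rels e)" for e
  proof -
    have iA_mult: "iA (signed A e (s m)) \<otimes>\<^bsub>G\<^esub> iA (signed A e (s n)) = iA (signed A e (s m) \<otimes>\<^bsub>A\<^esub> signed A e (s n))" for m n
      by (simp add: hom_mult [OF iA])
    have "signed G True (iF (lam m)) = iF (lam m)" for m
      by (simp add: signed_def)
    moreover have "iF (lam m) \<in> carrier G" "iA (signed A e (s q)) \<in> carrier G" for m q
      using hom_in_carrier [OF iF] hom_in_carrier [OF iA] by simp_all
    ultimately show ?thesis
      using swap [of "lam _" "signed A e (s _)"]
      by (auto simp: satisfies_def mixed_rels_def signed_iA f_simps iA_mult act_gen pw_gen S_gen_def transpose_def
          simp del: gen_image.simps)
  qed
  moreover have "satisfies G ?f (letter_rels Sig R\<^sub>A)"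
  proof -
    have "word_eval G (\<lambda>m. ?f (Sig m)) w = iA (word_eval A s w)" for w
      using hom_word_eval [OF iA A \<open>group G\<close>, of s w] by (simp add: f_simps del: gen_image.simps)
    then show ?thesis
      using presented_byD(2) [OF pres A]
      unfolding satisfies_letter_rels by (auto simp: satisfies_def split_beta simp del: gen_image.simps)
  qed
  ultimately have "satisfies G ?f R"
    using R_upper unfolding satisfies_def by blast
  then obtain h where h: "h \<in> hom ?P G" and hw: "\<And>w. h (word_class R w) = word_eval G ?f w"
    using hom_from_presented_group [OF \<open>group G\<close>, of ?f R] f by blast
  interpret h: group_hom ?P G h
    using h by (simp add: group_hom_def group_hom_axioms_def P.is_group G.is_group)
  have h_gen: "h (generator_class R x) = ?f x" for x
    by (simp add: generator_class_conv hw signed_def del: gen_image.simps)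

  define L where "L m = generator_class R (Lam m)" for m
  define T where "T m = generator_class R (Sig m)" for m
  have LT [simp]: "L m \<in> carrier ?P" "T m \<in> carrier ?P" for m
    by (simp_all add: L_def T_def)
  have sat: "satisfies ?P (generator_class R) forest_rels" "satisfies ?P (generator_class R) (mixed_rels e)"
    "satisfies ?P T R\<^sub>A" for e
    using R_lower R_mixed satisfies_presented_group [of forest_rels R]
      satisfies_presented_group [of "mixed_rels True" R] satisfies_presented_group [of "letter_rels Sig R\<^sub>A" R]
    by (cases e; auto simp: satisfies_letter_rels T_def [abs_def])+
  have "L q \<otimes>\<^bsub>?P\<^esub> L m = L m \<otimes>\<^bsub>?P\<^esub> L (Suc q)" if "m < q" for m q
    using sat(1) that by (force simp: satisfies_def forest_rels_def signed_def L_def)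
  then obtain \<phi>F where \<phi>F: "\<phi>F \<in> hom forest_monoid ?P"
    and \<phi>F_one: "\<phi>F ?one = \<one>\<^bsub>?P\<^esub>" and \<phi>F_lam: "\<And>m. \<phi>F (lam m) = L m"
    using hom_from_forest_monoid [OF P.is_monoid, of L] by auto
  obtain \<phi>A where \<phi>A: "\<phi>A \<in> hom A ?P" and \<phi>A_s: "\<And>m. \<phi>A (s m) = T m"
    using presented_byD(4) [OF pres A P.is_group, of T] sat(3) by auto
  have \<phi>C [simp]: "is_forest u \<Longrightarrow> \<phi>F u \<in> carrier ?P" "\<alpha> \<in> carrier A \<Longrightarrow> \<phi>A \<alpha> \<in> carrier ?P" for u \<alpha>
    using hom_in_carrier [OF \<phi>F] hom_in_carrier [OF \<phi>A] by simp_all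
  have \<phi>F_mult: "\<phi>F (forest_mult u v) = \<phi>F u \<otimes>\<^bsub>?P\<^esub> \<phi>F v" if "is_forest u" "is_forest v" for u v
    using hom_mult [OF \<phi>F, of u v] that by simp
  note \<phi>A_mult = hom_mult [OF \<phi>A]

  \<comment> \<open>These are the mixed relations of \<open>P\<close>, one for each case of the definition of the actions on generators.\<close>
  have swap_gen: "\<phi>A (signed A e (s q)) \<otimes>\<^bsub>?P\<^esub> L m =
      L (S_gen q m) \<otimes>\<^bsub>?P\<^esub> \<phi>A (pw (signed A e (s q)) (lam m))" for e q m
  proof -
    have \<phi>_signed: "\<phi>A (signed A e (s q)) = signed ?P e (T q)" for q
      by (simp add: hom_signed [OF \<phi>A A P.is_group] \<phi>A_s)
    have eqs: "word_eval ?P (generator_class R) r = word_eval ?P (generator_class R) r'"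
      if "(r, r') \<in> mixed_rels e" for r r'
      using sat(2) [of e] that by (auto simp: satisfies_def)
    have L1: "signed ?P True (L m) = L m" for m
      by (simp add: signed_def)
    note simps = L1 \<phi>_signed pw_gen S_gen_def \<phi>A_mult
    consider "m < q" | "m = q" | "m = Suc q" | "m > Suc q"
      by linarith
    then show ?thesis
    proof cases
      case 1
      then show ?thesis
        using eqs [of "[sig_letter e q, lam_letter m]" "[lam_letter m, sig_letter e (q + 1)]"]
        by (simp add: simps mixed_rels_def flip: L_def T_def)
    next
      case 2
      then show ?thesis
        using eqs [of "[sig_letter e q, lam_letter q]" "[lam_letter (q + 1), sig_letter e q, sig_letter e (q + 1)]"]
        by (simp add: simps mixed_rels_def flip: L_def T_def)
    next
      case 3
      then show ?thesis
        using eqs [of "[sig_letter e q, lam_letter (q + 1)]" "[lam_letter q, sig_letter e (q + 1), sig_letter e q]"]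
        by (simp add: simps mixed_rels_def flip: L_def T_def)
    next
      case 4
      then show ?thesis
        using eqs [of "[sig_letter e q, lam_letter m]" "[lam_letter m, sig_letter e q]"]
        by (simp add: simps mixed_rels_def flip: L_def T_def)
    qed
  qed
  \<comment> \<open>Acting on a \<open>\<lambda>\<^sub>m\<close> always gives some \<open>\<lambda>\<^sub>n\<close>, which keeps the induction on a word for \<open>\<alpha>\<close> among the \<open>\<lambda>\<close>.\<close>
  have swap_lam: "\<exists>n. act \<alpha> (lam m) = lam n \<and> \<phi>A \<alpha> \<otimes>\<^bsub>?P\<^esub> L m = L n \<otimes>\<^bsub>?P\<^esub> \<phi>A (pw \<alpha> (lam m))"
    if \<alpha>: "\<alpha> \<in> carrier A" for \<alpha> m
  proof -
    have "\<exists>n. act (word_eval A s w) (lam m) = lam n \<and>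
        \<phi>A (word_eval A s w) \<otimes>\<^bsub>?P\<^esub> L m = L n \<otimes>\<^bsub>?P\<^esub> \<phi>A (pw (word_eval A s w) (lam m))" for w
    proof (induction w)
      case Nil
      then show ?case
        using hom_one [OF \<phi>A A P.is_group] by auto
    next
      case (Cons p w)
      obtain q e where p: "p = (q, e)"
        by (cases p)
      let ?a = "signed A e (s q)" and ?b = "word_eval A s w"
      obtain n where n: "act ?b (lam m) = lam n"
        and IH: "\<phi>A ?b \<otimes>\<^bsub>?P\<^esub> L m = L n \<otimes>\<^bsub>?P\<^esub> \<phi>A (pw ?b (lam m))"
        using Cons by blast
      have "\<phi>A (?a \<otimes>\<^bsub>A\<^esub> ?b) \<otimes>\<^bsub>?P\<^esub> L m = \<phi>A ?a \<otimes>\<^bsub>?P\<^esub> L n \<otimes>\<^bsub>?P\<^esub> \<phi>A (pw ?b (lam m))"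
        by (simp add: \<phi>A_mult P.m_assoc IH)
      also have "\<dots> = L (S_gen q n) \<otimes>\<^bsub>?P\<^esub> \<phi>A (pw (?a \<otimes>\<^bsub>A\<^esub> ?b) (lam m))"
        by (simp add: swap_gen pw_mult n \<phi>A_mult P.m_assoc)
      finally show ?case
        by (intro exI [of _ "S_gen q n"]) (simp add: p act_mult n act_gen)
    qed
    then show ?thesis
      using presented_byD(3) [OF pres A \<alpha>] by blast
  qed
  have swap_forest: "\<phi>A \<alpha> \<otimes>\<^bsub>?P\<^esub> \<phi>F u = \<phi>F (act \<alpha> u) \<otimes>\<^bsub>?P\<^esub> \<phi>A (pw \<alpha> u)"
    if "is_forest u" "\<alpha> \<in> carrier A" for u \<alpha>
    using that
  proof (induction arbitrary: \<alpha> rule: forest_induct)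
    case trivial
    then show ?case
      by (simp add: \<phi>F_one)
  next
    case (graft m u)
    obtain n where n: "act \<alpha> (lam m) = lam n"
      and eq: "\<phi>A \<alpha> \<otimes>\<^bsub>?P\<^esub> L m = L n \<otimes>\<^bsub>?P\<^esub> \<phi>A (pw \<alpha> (lam m))"
      using swap_lam [OF graft.prems] by blast
    let ?\<beta> = "pw \<alpha> (lam m)"
    have "\<phi>A \<alpha> \<otimes>\<^bsub>?P\<^esub> \<phi>F (forest_mult (lam m) u) = L n \<otimes>\<^bsub>?P\<^esub> (\<phi>A ?\<beta> \<otimes>\<^bsub>?P\<^esub> \<phi>F u)"
      using graft.hyps graft.prems by (simp add: \<phi>F_mult \<phi>F_lam eq flip: P.m_assoc)
    also have "\<dots> = \<phi>F (act \<alpha> (forest_mult (lam m) u)) \<otimes>\<^bsub>?P\<^esub> \<phi>A (pw \<alpha> (forest_mult (lam m) u))"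
      using graft by (simp add: act_forest pw_forest n \<phi>F_mult \<phi>F_lam P.m_assoc)
    finally show ?case
      using graft by (simp add: lam_mult)
  qed

  \<comment> \<open>By \<open>swap_forest\<close> the product formula of the Zappa--Szep product holds in \<open>P\<close>.\<close>
  define \<Phi> where "\<Phi> = (\<lambda>(u, \<alpha>). \<phi>F u \<otimes>\<^bsub>?P\<^esub> \<phi>A \<alpha>)"
  have \<Phi>: "\<Phi> \<in> hom ?M ?P"
  proof (rule homI)
    fix a b assume a: "a \<in> carrier ?M" and b: "b \<in> carrier ?M"
    obtain u \<alpha> v \<beta> where ab: "a = (u, \<alpha>)" "b = (v, \<beta>)"
      by (cases a; cases b)
    have "\<Phi> a \<otimes>\<^bsub>?P\<^esub> \<Phi> b = \<phi>F u \<otimes>\<^bsub>?P\<^esub> (\<phi>A \<alpha> \<otimes>\<^bsub>?P\<^esub> \<phi>F v) \<otimes>\<^bsub>?P\<^esub> \<phi>A \<beta>"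
      using a b by (simp add: ab \<Phi>_def P.m_assoc)
    also have "\<dots> = \<Phi> (a \<otimes>\<^bsub>?M\<^esub> b)"
      using a b by (simp add: ab \<Phi>_def swap_forest \<phi>F_mult \<phi>A_mult P.m_assoc)
    finally show "\<Phi> (a \<otimes>\<^bsub>?M\<^esub> b) = \<Phi> a \<otimes>\<^bsub>?P\<^esub> \<Phi> b" ..
  qed (auto simp: \<Phi>_def)
  have \<Phi>_gen: "\<Phi> (lam m, \<one>\<^bsub>A\<^esub>) = L m" "\<Phi> (?one, s m) = T m" for m
    using hom_one [OF \<phi>A A P.is_group] by (simp_all add: \<Phi>_def \<phi>F_lam \<phi>F_one \<phi>A_s)

  have h\<phi>F: "h (\<phi>F u) = iF u" if "is_forest u" for u
    using that
  proof (induction rule: forest_induct)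
    case trivial
    then show ?case
      using i_one by (simp add: \<phi>F_one iF_def)
  next
    case (graft m u)
    have "h (\<phi>F (forest_mult (lam m) u)) = iF (forest_mult (lam m) u)"
      using graft hom_mult [OF iF, of "lam m" u]
      by (simp add: \<phi>F_mult \<phi>F_lam L_def h_gen f_simps del: gen_image.simps)
    then show ?case
      using graft by (simp add: lam_mult)
  qed
  have h\<phi>A: "h (\<phi>A \<alpha>) = iA \<alpha>" if \<alpha>: "\<alpha> \<in> carrier A" for \<alpha>
  proof -
    obtain w where w: "\<alpha> = word_eval A s w"
      using presented_byD(3) [OF pres A \<alpha>] by blast
    have "h (\<phi>A \<alpha>) = word_eval G (\<lambda>m. h (T m)) w"
      using hom_word_eval [OF \<phi>A A P.is_group, of s w] hom_word_eval [OF h P.is_group \<open>group G\<close>, of T w]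
      by (simp add: w \<phi>A_s)
    also have "\<dots> = iA \<alpha>"
      using hom_word_eval [OF iA A \<open>group G\<close>, of s w]
      by (simp add: w T_def h_gen f_simps del: gen_image.simps)
    finally show ?thesis .
  qed

  have "h \<in> iso ?P G"
  proof (rule iso_of_right_fraction_group [OF fractions _ h \<Phi>])
    show "h (\<Phi> a) = i a" if "a \<in> carrier ?M" for a
      using that by (auto simp: \<Phi>_def h\<phi>F h\<phi>A i_split)
    show "generator_class R x \<in> \<Phi> ` carrier ?M" for x
    proof (cases x)
      case (Lam m)
      then show ?thesis
        by (intro image_eqI [of _ _ "(lam m, \<one>\<^bsub>A\<^esub>)"]) (simp_all add: \<Phi>_gen L_def)
    next
      case (Sig m)
      then show ?thesis
        by (intro image_eqI [of _ _ "(?one, s m)"]) (simp_all add: \<Phi>_gen T_def)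
    qed
    show "\<Phi> \<one>\<^bsub>?M\<^esub> = \<one>\<^bsub>?P\<^esub>"
      using hom_one [OF \<phi>A A P.is_group] by (simp add: \<Phi>_def \<phi>F_one)
  qed auto
  then show ?thesis
    using h_gen unfolding presented_by_def by blast
qed

section \<open>The groups of fractions over permutations and over braids\<close>

lemma group_B_inf: "group B_inf"
  by (simp add: B_inf_def group_presented_group)

lemma B_inf_presentation: "presented_by B_inf B_gen (braid_rels id)"
  using presented_by_presented_group [of "braid_rels id"]
  by (simp add: B_inf_def B_gen_def [abs_def] id_def)

lemma letter_rels_braid_rels: "letter_rels Sig (braid_rels id) = braid_rels Sig"
  unfolding braid_rels_def letter_rels_Un letter_rels_Collect by simp

lemma letter_rels_square_rels: "letter_rels Sig (square_rels id) = involution_rels"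
  unfolding square_rels_def involution_rels_def letter_rels_Collect by simp

text \<open>
  Since \<open>\<sigma>\<^sub>m\<^sup>2 = 1\<close>, the letters \<open>\<sigma>\<^sub>m\<close> and \<open>\<sigma>\<^sub>m\<^sup>-\<^sup>1\<close> agree in the presented group, and so do the
  two families of mixed relations.
\<close>

lemma V_rels_mixed_negative: "satisfies (presented_group V_rels) (generator_class V_rels) (mixed_rels False)"
proof -
  let ?P = "presented_group V_rels" and ?g = "generator_class V_rels"
  interpret group ?P by (rule group_presented_group)
  have "satisfies ?P ?g involution_rels"
    by (rule satisfies_presented_group) (auto simp: V_rels_def)
  then have "word_eval ?P ?g [sig_letter True m, sig_letter True m] = word_eval ?P ?g []" for m
    unfolding satisfies_def involution_rels_def by blast
  then have square: "?g (Sig m) \<otimes>\<^bsub>?P\<^esub> ?g (Sig m) = \<one>\<^bsub>?P\<^esub>" for m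
    by (simp add: signed_def)
  have "inv\<^bsub>?P\<^esub> ?g (Sig m) = ?g (Sig m)" for m
    by (rule inv_equality [OF square]) simp_all
  then have "signed ?P False (?g (Sig m)) = signed ?P True (?g (Sig m))" for m
    by (simp add: signed_def)
  moreover have "satisfies ?P ?g (mixed_rels True)"
    by (rule satisfies_presented_group) (auto simp: V_rels_def)
  ultimately show ?thesis
    unfolding mixed_rels_def satisfies_Un satisfies_Collect by simp
qed

theorem theorem1:
  fixes V :: "'v monoid" and BV :: "'w monoid"
  shows
    "(\<forall>act pw i.
        zappa_szep_actions S_inf S_gen act pw \<and>
        right_fraction_group (zappa_szep_product S_inf act pw) V i \<longrightarrow>
        presented_by V (gen_image S_inf S_gen i) V_rels) \<and>
     (\<forall>act pw i.
        zappa_szep_actions B_inf B_gen act pw \<and>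
        right_fraction_group (zappa_szep_product B_inf act pw) BV i \<longrightarrow>
        presented_by BV (gen_image B_inf B_gen i) BV_rels)"
proof (intro conjI allI impI; elim conjE)
  fix act pw i
  assume "zappa_szep_actions S_inf S_gen act pw"
    "right_fraction_group (zappa_szep_product S_inf act pw) V i"
  with group_S_inf S_inf_presentation show "presented_by V (gen_image S_inf S_gen i) V_rels"
    by (rule zappa_szep_fraction_group_presentation)
      (auto simp: V_rels_def letter_rels_Un letter_rels_braid_rels letter_rels_square_rels
        V_rels_mixed_negative [unfolded V_rels_def])
next
  fix act pw i
  assume "zappa_szep_actions B_inf B_gen act pw"
    "right_fraction_group (zappa_szep_product B_inf act pw) BV i"
  moreover have "satisfies (presented_group BV_rels) (generator_class BV_rels) (mixed_rels False)"
    by (rule satisfies_presented_group) (auto simp: BV_rels_def)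
  ultimately show "presented_by BV (gen_image B_inf B_gen i) BV_rels"
    by (intro zappa_szep_fraction_group_presentation [OF group_B_inf B_inf_presentation])
      (auto simp: BV_rels_def letter_rels_braid_rels)
qed

end
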